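(* For every real number $\varepsilon > 0$ and every Hamiltonian graph $F$, there exists a constant $C = C(F,\varepsilon) > 0$ such that for every positive integer $n$ and every $n$-vertex graph $G$, $$N_{\mathrm{factor}}(F;G) \leq \left((1+\varepsilon)\frac{|V(F)|}{|\mathrm{Aut}(F)|}\right)^{\frac{n}{|V(F)|}} \cdot \left(\prod_{v\in V(G)} \frac{d_G(v)+C}{e}\right)^{1-\frac{1}{|V(F)|}}.$$
   Context: All graphs are finite and simple. $\mathrm{Aut}(F)$ is the automorphism group of $F$, $d_G(v)$ is the degree of $v$ in $G$, and $e$ is Euler's number. An $F$-factor of $G$ is a spanning subgraph of $G$ that is a vertex-disjoint union of copies of $F$ (i.e. isomorphic to the disjoint union of $|V(G)|/|V(F)|$ copies of $F$). $N_{\mathrm{factor}}(F;G)$ is the number of distinct $F$-factors in $G$ (it is $0$ if $|V(F)|$ does not divide $|V(G)|$). A graph $F$ on $\ell$ vertices is Hamiltonian if it contains the cycle $C_\ell$ as a spanning subgraph; by convention $C_2$ is a single edge, so $K_2$ is included (here $\ell\ge 2$). *)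

theory Defs
  imports Complex_Main "HOL-Combinatorics.Permutations"
begin

datatype 'a sgraph = SGraph (verts: "'a set") (edges: "'a set set")

definition simple_graph :: "'a sgraph \<Rightarrow> bool" where
  "simple_graph G \<longleftrightarrow> finite (verts G) \<and> edges G \<subseteq> {e. e \<subseteq> verts G \<and> card e = 2}"

definition degree :: "'a sgraph \<Rightarrow> 'a \<Rightarrow> nat" where
  "degree G v = card {w \<in> verts G. {v, w} \<in> edges G}"

definition spanning_subgraph :: "'a sgraph \<Rightarrow> 'a sgraph \<Rightarrow> bool" where
  "spanning_subgraph H G \<longleftrightarrow> verts H = verts G \<and> edges H \<subseteq> edges G"

definition graph_iso :: "'a sgraph \<Rightarrow> 'b sgraph \<Rightarrow> bool" where
  "graph_iso G H \<longleftrightarrow>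
     (\<exists>f. bij_betw f (verts G) (verts H) \<and> edges H = (\<lambda>e. f ` e) ` edges G)"

text \<open>Automorphisms are extended by the identity outside the vertex set, so that
  distinct automorphisms are counted once each.\<close>

definition automorphisms :: "'a sgraph \<Rightarrow> ('a \<Rightarrow> 'a) set" where
  "automorphisms F = {f. f permutes verts F \<and> (\<lambda>e. f ` e) ` edges F = edges F}"

text \<open>For \<open>l = 2\<close> the two edges \<open>{0, 1}\<close> and \<open>{1, 0}\<close> coincide, so
  \<open>cycle_graph 2\<close> is a single edge.\<close>

definition cycle_graph :: "nat \<Rightarrow> nat sgraph" where
  "cycle_graph l = SGraph {..<l} ((\<lambda>i. {i, Suc i mod l}) ` {..<l})"

definition hamiltonian :: "'a sgraph \<Rightarrow> bool" where
  "hamiltonian F \<longleftrightarrow> card (verts F) \<ge> 2 \<and>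
     (\<exists>H. spanning_subgraph H F \<and> graph_iso (cycle_graph (card (verts F))) H)"

definition is_factor :: "'a sgraph \<Rightarrow> 'b sgraph \<Rightarrow> 'b sgraph \<Rightarrow> bool" where
  "is_factor F G H \<longleftrightarrow> spanning_subgraph H G \<and>
     (\<exists>\<K>. (\<forall>K\<in>\<K>. graph_iso F K) \<and>
          pairwise (\<lambda>K L. verts K \<inter> verts L = {}) \<K> \<and>
          verts H = (\<Union>K\<in>\<K>. verts K) \<and>
          edges H = (\<Union>K\<in>\<K>. edges K))"

definition N_factor :: "'a sgraph \<Rightarrow> 'b sgraph \<Rightarrow> nat" where
  "N_factor F G = card {H. is_factor F G H}"

text \<open>The set counted by \<open>N_factor\<close> is finite, so \<open>card\<close> is its true size.\<close>

lemma finite_factors: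
  assumes "simple_graph G"
  shows "finite {H. is_factor F G H}"
proof -
  have "edges G \<subseteq> Pow (verts G)" "finite (verts G)"
    using assms by (auto simp: simple_graph_def)
  then have "finite (edges G)"
    using finite_subset by blast
  moreover have "{H. is_factor F G H} \<subseteq> SGraph (verts G) ` Pow (edges G)"
  proof
    fix H assume "H \<in> {H. is_factor F G H}"
    then have "verts H = verts G" "edges H \<subseteq> edges G"
      by (auto simp: is_factor_def spanning_subgraph_def)
    then show "H \<in> SGraph (verts G) ` Pow (edges G)"
      by (cases H) auto
  qed
  ultimately show ?thesis
    by (meson finite_Pow_iff finite_imageI finite_subset)
qed

end

theory Submission
  imports Defs "HOL-Real_Asymp.Real_Asymp"
begin

text \<open>
  Let \<open>l\<close> be the number of vertices of \<open>F\<close>, let \<open>n = l * r\<close> be that of \<open>G\<close>, and list the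
  vertices of \<open>F\<close> along a Hamiltonian cycle. Choosing an isomorphism from \<open>F\<close> to every component of
  an \<open>F\<close>-factor turns the factor into a set of \<open>r\<close> rooted directed \<open>l\<close>-cycles of \<open>G\<close> that partition
  the vertex set, here called a cycle tiling. The tiling determines the factor, and each factor
  yields at least \<open>\<bar>Aut F\<bar>\<^sup>r\<close> tilings (\<open>N_factor_times_automorphisms_le\<close>), so it is enough to
  bound the number \<open>N\<close> of cycle tilings.

  Fix a linear order of the vertices and disclose a tiling as follows: the first vertex that is not
  yet covered (the leader of its cycle) tells its index in its cycle, and then the cycle is
  followed from the leader, one vertex at a time, until all its \<open>l\<close> vertices are known.
  Guessing each of these answers uniformly among the possible ones (\<open>l\<close> indices, respectively the
  neighbours of the current vertex in cycles not yet completed) hits a given tiling \<open>S\<close> with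
  probability \<open>q S\<close>, its weight. These are probabilities of disjoint events, so their sum is at most
  \<open>1\<close> (\<open>sum_tiling_weights_le_1\<close>), and concavity of the logarithm gives that \<open>ln N\<close> is at most the
  average of \<open>- ln (q S)\<close> over all tilings. This is the entropy method without entropy.

  The inequality holds for every order, hence also after averaging over a uniformly random
  order, and that average can be taken for one tiling at a time. By symmetry
  the order in which the \<open>r\<close> cycles are completed is uniform, and every vertex of a cycle is
  equally likely to be its leader. A vertex \<open>u\<close> asks for its successor unless that successor is the
  leader, which happens with probability \<open>1 / l\<close>; this is the exponent \<open>1 - 1 / l\<close>. If the cycle of
  \<open>u\<close> is the \<open>j\<close>-th one counted from the end, then on average at most \<open>d u * j / r\<close> of the
  \<open>d u\<close> neighbours are still available, plus at most \<open>l\<close> in the cycle of \<open>u\<close> itself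
  (\<open>sum_ln_later_not_first_le\<close>). As \<open>j\<close> is uniform on \<open>{1..r}\<close>, Jensen's inequality leaves the mean of
  \<open>ln (l + d u * j / r)\<close>, which is close to the integral of \<open>ln (d u * x)\<close> over the unit interval,
  that is, to \<open>ln (d u / e)\<close>. The additive constant \<open>C\<close> and the factor \<open>1 + \<epsilon>\<close> absorb the
  discretisation and the summand \<open>l\<close> (\<open>average_ln_le\<close>). The index of the leader contributes the
  factor \<open>l\<close> for each of the \<open>r\<close> cycles.
\<close>

section \<open>Averages of logarithms over equally spaced points\<close>

text \<open>The right-hand side is the integral of \<open>ln\<close> from \<open>h + \<delta>\<close> to \<open>(r + 1) * h + \<delta>\<close>, expressed by its
  antiderivative \<open>x * (ln x - 1)\<close>. It dominates the left Riemann sum because \<open>ln\<close> is increasing.\<close>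

lemma sum_ln_shifted_le:
  fixes h \<delta> :: real
  assumes "h > 0" "\<delta> > 0"
  shows "h * (\<Sum>j=1..r. ln (real j * h + \<delta>)) \<le>
    ((real r + 1) * h + \<delta>) * (ln ((real r + 1) * h + \<delta>) - 1) - (h + \<delta>) * (ln (h + \<delta>) - 1)"
proof (induction r)
  case 0
  then show ?case by simp
next
  case (Suc r)
  define x where "x = (real r + 1) * h + \<delta>"
  have x: "x > 0" using assms by (simp add: x_def add_nonneg_pos)
  have "ln (x / (x + h)) \<le> x / (x + h) - 1"
    using x assms by (intro ln_le_minus_one) simp
  then have "ln x - ln (x + h) \<le> - h / (x + h)"
    using x assms by (simp add: ln_div field_simps)
  then have "(x + h) * (ln x - ln (x + h)) \<le> (x + h) * (- h / (x + h))"
    using x assms by (intro mult_left_mono) auto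
  also have "(x + h) * (- h / (x + h)) = - h" using x assms by simp
  finally have *: "h * ln x \<le> (x + h) * (ln (x + h) - 1) - x * (ln x - 1)"
    using x assms by (simp add: algebra_simps)
  have "(real (Suc r) + 1) * h + \<delta> = x + h"
    by (simp add: x_def algebra_simps)
  moreover have "real (Suc r) * h + \<delta> = x" by (simp add: x_def algebra_simps)
  ultimately show ?case
    using Suc.IH * by (simp add: algebra_simps x_def)
qed

text \<open>For large \<open>r\<close> the factorisation \<open>l + d * x \<le> (d + C) * (x + \<delta>)\<close>, valid once \<open>C * \<delta> \<ge> l\<close>, separates
  \<open>d\<close> from the average, and \<open>sum_ln_shifted_le\<close> bounds the average of \<open>ln (j / r + \<delta>)\<close> by a number
  close to \<open>- 1\<close>. For small \<open>r\<close> the bound \<open>d \<le> l * r\<close> makes all arguments of \<open>ln\<close> smaller than a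
  constant, and \<open>C\<close> is taken large enough to win outright.\<close>

lemma average_ln_le:
  fixes \<eta> :: real and l :: nat
  assumes "\<eta> > 0" "l \<ge> 1"
  shows "\<exists>C>0. \<forall>r\<ge>1. \<forall>d\<le>l * r.
    (\<Sum>j=1..r. ln (real l + real d * (real j / real r))) / real r \<le> ln ((real d + C) / exp 1) + \<eta>"
proof -
  \<comment> \<open>With \<open>y = 1 / r + \<delta>\<close> this is the error left by the integral of \<open>ln\<close> from \<open>y\<close> to \<open>1 + y\<close> against \<open>- 1\<close>.\<close>
  have "((\<lambda>y::real. (1 + y) * ln (1 + y) - y * ln y) \<longlongrightarrow> 0) (at_right 0)"
    by real_asymp
  then have "\<forall>\<^sub>F y in at_right 0. (1 + y) * ln (1 + y) - y * ln y < (\<eta>::real)"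
    using assms(1) by (auto simp: tendsto_iff dist_real_def elim!: allE[of _ \<eta>] eventually_mono)
  then obtain b where b: "b > 0"
    "\<And>y. 0 < y \<Longrightarrow> y < b \<Longrightarrow> (1 + y) * ln (1 + y) - y * ln y < \<eta>"
    by (auto simp: eventually_at_right_field)
  define \<delta> where "\<delta> = b / 2"
  have \<delta>: "\<delta> > 0" using b by (simp add: \<delta>_def)
  define r0 where "r0 = nat \<lceil>2 / b\<rceil> + 1"
  define C where "C = max (real l / \<delta>) (exp 1 * (2 * real l * real r0))"
  have Cpos: "C > 0" using assms \<delta> by (auto simp: C_def less_max_iff_disj)
  have "(\<Sum>j=1..r. ln (real l + real d * (real j / real r))) / real r \<le> ln ((real d + C) / exp 1) + \<eta>"
    if r: "r \<ge> 1" and d: "d \<le> l * r" for r d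
  proof (cases "r \<le> r0")
    case True
    have "ln (real l + real d * (real j / real r)) \<le> ln ((real d + C) / exp 1)"
      if j: "j \<in> {1..r}" for j
    proof -
      have "real d * (real j / real r) \<le> real d * 1"
        using j r by (intro mult_left_mono) auto
      also have "\<dots> \<le> real l * real r" using d by (metis mult.right_neutral of_nat_le_iff of_nat_mult)
      also have "\<dots> \<le> real l * real r0" using True by (intro mult_left_mono) auto
      finally have "real l + real d * (real j / real r) \<le> real l * 1 + real l * real r0" by simp
      also have "\<dots> \<le> real l * real r0 + real l * real r0"
        by (intro add_right_mono mult_left_mono) (auto simp: r0_def)
      also have "\<dots> = exp 1 * (2 * real l * real r0) / exp 1" by simp
      also have "\<dots> \<le> (real d + C) / exp 1"
        by (intro divide_right_mono) (auto simp: C_def)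
      finally show ?thesis using assms by (intro ln_mono) (auto intro!: add_pos_nonneg)
    qed
    then have "(\<Sum>j=1..r. ln (real l + real d * (real j / real r))) \<le> (\<Sum>j=1..r. ln ((real d + C) / exp 1))"
      by (intro sum_mono) auto
    then have "(\<Sum>j=1..r. ln (real l + real d * (real j / real r))) / real r \<le> ln ((real d + C) / exp 1)"
      using r by (subst pos_divide_le_eq) (auto simp: mult.commute)
    then show ?thesis using assms(1) by linarith
  next
    case False
    define h where "h = 1 / real r"
    have "2 / b < real r" using False unfolding r0_def by linarith
    then have h: "h > 0" "h < b / 2" "real r * h = 1"
      using r b by (auto simp: h_def field_simps)
    define y where "y = h + \<delta>"
    have y: "0 < y" "y < b" using h \<delta> by (auto simp: y_def \<delta>_def)
    have t: "ln (real l + real d * (real j / real r)) \<le> ln (real d + C) + ln (real j * h + \<delta>)"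
      if j: "j \<in> {1..r}" for j
    proof -
      have "real l \<le> C * \<delta>" using \<delta> by (simp add: C_def field_simps max_def)
      also have "\<dots> \<le> C * (real j * h + \<delta>)" using Cpos h by (intro mult_left_mono) auto
      finally have "real l \<le> C * (real j * h + \<delta>)" .
      moreover have "real d * \<delta> \<ge> 0" using \<delta> by simp
      ultimately have "real l + real d * (real j * h) \<le> (real d + C) * (real j * h + \<delta>)"
        by (simp add: distrib_left distrib_right)
      moreover have "real l + real d * (real j * h) > 0" using assms h by (intro add_pos_nonneg) auto
      moreover have "real j * h + \<delta> > 0" using h \<delta> by (simp add: add_nonneg_pos)
      ultimately have "ln (real l + real d * (real j * h)) \<le> ln ((real d + C) * (real j * h + \<delta>))"
        by (intro ln_mono) auto
      also have "\<dots> = ln (real d + C) + ln (real j * h + \<delta>)"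
        using \<open>real j * h + \<delta> > 0\<close> Cpos by (intro ln_mult_pos) (auto intro!: add_nonneg_pos)
      finally show ?thesis by (simp add: h_def)
    qed
    have "(\<Sum>j=1..r. ln (real l + real d * (real j / real r))) \<le>
        (\<Sum>j=1..r. ln (real d + C) + ln (real j * h + \<delta>))"
      by (intro sum_mono t) auto
    then have "h * (\<Sum>j=1..r. ln (real l + real d * (real j / real r))) \<le>
        h * (\<Sum>j=1..r. ln (real d + C) + ln (real j * h + \<delta>))"
      using h by (intro mult_left_mono) auto
    also have "\<dots> = ln (real d + C) + h * (\<Sum>j=1..r. ln (real j * h + \<delta>))"
      using h by (simp add: sum.distrib distrib_left mult.assoc[symmetric] mult.commute)
    also have "h * (\<Sum>j=1..r. ln (real j * h + \<delta>)) \<le>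
       ((real r + 1) * h + \<delta>) * (ln ((real r + 1) * h + \<delta>) - 1) - (h + \<delta>) * (ln (h + \<delta>) - 1)"
      by (rule sum_ln_shifted_le) (use h \<delta> in auto)
    also have "(real r + 1) * h + \<delta> = 1 + y" using h by (simp add: y_def algebra_simps)
    also have "h + \<delta> = y" by (simp add: y_def)
    also have "(1 + y) * (ln (1 + y) - 1) - y * (ln y - 1) \<le> \<eta> - 1"
      using b(2)[of y] y by (simp add: algebra_simps)
    finally have "h * (\<Sum>j=1..r. ln (real l + real d * (real j / real r))) \<le> ln (real d + C) + (\<eta> - 1)"
      by simp
    then show ?thesis using Cpos by (simp add: h_def ln_div add_nonneg_pos field_simps)
  qed
  with Cpos show ?thesis by blast
qed

section \<open>Tilings by directed cycles and their sequential disclosure\<close>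

definition directed_cycles :: "('b \<Rightarrow> 'b set) \<Rightarrow> nat \<Rightarrow> 'b set \<Rightarrow> 'b list set" where
  "directed_cycles nb l U =
     {L. length L = l \<and> distinct L \<and> set L \<subseteq> U \<and> (\<forall>i<l. L ! (Suc i mod l) \<in> nb (L ! i))}"

text \<open>A list stands for a rooted directed cycle, so rotations of a list count as different cycles and a
  tiling carries a choice of root in each of its cycles.\<close>

definition cycle_tilings :: "('b \<Rightarrow> 'b set) \<Rightarrow> nat \<Rightarrow> 'b set \<Rightarrow> 'b list set set" where
  "cycle_tilings nb l U =
     {S. S \<subseteq> directed_cycles nb l U \<and> pairwise (\<lambda>L L'. set L \<inter> set L' = {}) S \<and> \<Union>(set ` S) = U}"

text \<open>The function \<open>pos\<close> encodes a linear order of the vertices. The indices below are those of the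
  vertices whose successor has to be disclosed: all except the predecessor of the leader, the
  vertex of the cycle that comes first in the order.\<close>

definition exposed :: "('b \<Rightarrow> nat) \<Rightarrow> 'b list \<Rightarrow> nat set" where
  "exposed pos L = {i. i < length L \<and> pos (L ! (Suc i mod length L)) \<noteq> Min (pos ` set L)}"

text \<open>When \<open>u\<close> in the cycle \<open>L\<close> asks for its successor, exactly the cycles whose leaders precede the
  leader of \<open>L\<close> have been completed. Vertices of \<open>L\<close> itself still count as available, even
  those already visited.\<close>

definition available :: "('b \<Rightarrow> 'b set) \<Rightarrow> ('b \<Rightarrow> nat) \<Rightarrow> 'b list set \<Rightarrow> 'b list \<Rightarrow> 'b \<Rightarrow> 'b set" where
  "available nb pos S L u =
     nb u \<inter> \<Union>(set ` {L' \<in> S. Min (pos ` set L) \<le> Min (pos ` set L')})"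

text \<open>The probability that uniform guesses reproduce the tiling, where \<open>1 / l\<close> is the chance of
  guessing the index of the leader in its list.\<close>

definition tiling_weight :: "('b \<Rightarrow> 'b set) \<Rightarrow> ('b \<Rightarrow> nat) \<Rightarrow> nat \<Rightarrow> 'b list set \<Rightarrow> real" where
  "tiling_weight nb pos l S =
     (\<Prod>L\<in>S. 1 / real l * (\<Prod>i\<in>exposed pos L. 1 / real (card (available nb pos S L (L ! i)))))"

fun walks :: "('b \<Rightarrow> 'b set) \<Rightarrow> nat \<Rightarrow> 'b \<Rightarrow> 'b list set" where
  "walks nb 0 v = {[v]}"
| "walks nb (Suc k) v = (\<Union>w\<in>nb v. (#) v ` walks nb k w)"

lemma walksI:
  assumes "length W = Suc k" "hd W = v" "\<And>i. i < k \<Longrightarrow> W ! Suc i \<in> nb (W ! i)"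
  shows "W \<in> walks nb k v"
  using assms
proof (induction k arbitrary: W v)
  case 0
  then show ?case by (cases W) auto
next
  case (Suc k)
  then obtain W' where W: "W = v # W'" "length W' = Suc k" by (cases W) auto
  then obtain w W'' where W': "W' = w # W''" by (cases W') auto
  have "w \<in> nb v" using Suc.prems(3)[of 0] W W' by simp
  moreover have "W' \<in> walks nb k w"
    by (rule Suc.IH) (use W W' Suc.prems(3)[of "Suc _"] in auto)
  ultimately show ?case using W by auto
qed

lemma walks_length_hd: "W \<in> walks nb k v \<Longrightarrow> length W = Suc k \<and> hd W = v"
  by (induction k arbitrary: v W) auto

text \<open>The summand is the probability that a random walk, which moves to a uniformly chosen neighbour,
  follows \<open>W\<close>. The sum falls short of \<open>1\<close> only if a vertex without neighbours can be reached.\<close>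

lemma sum_walks_le_1:
  assumes "\<And>u. finite (nb u)"
  shows "finite (walks nb k v)"
    "(\<Sum>W\<in>walks nb k v. \<Prod>i<k. 1 / real (card (nb (W ! i)))) \<le> 1"
proof -
  show fin: "finite (walks nb k v)" for k v
    by (induction k arbitrary: v) (use assms in auto)
  show "(\<Sum>W\<in>walks nb k v. \<Prod>i<k. 1 / real (card (nb (W ! i)))) \<le> 1"
  proof (induction k arbitrary: v)
    case 0
    then show ?case by simp
  next
    case (Suc k)
    have "(\<Sum>W\<in>walks nb (Suc k) v. \<Prod>i<Suc k. 1 / real (card (nb (W ! i)))) =
      (\<Sum>w\<in>nb v. \<Sum>W\<in>(#) v ` walks nb k w. \<Prod>i<Suc k. 1 / real (card (nb (W ! i))))"
      unfolding walks.simps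
    proof (rule sum.UNION_disjoint)
      show "\<forall>w\<in>nb v. \<forall>w'\<in>nb v. w \<noteq> w' \<longrightarrow> (#) v ` walks nb k w \<inter> (#) v ` walks nb k w' = {}"
        by (auto dest!: walks_length_hd)
    qed (use assms fin in auto)
    also have "\<dots> = (\<Sum>w\<in>nb v. \<Sum>W\<in>walks nb k w.
        1 / real (card (nb v)) * (\<Prod>i<k. 1 / real (card (nb (W ! i)))))"
      by (subst sum.reindex) (auto simp: prod.lessThan_Suc_shift simp del: prod.lessThan_Suc)
    also have "\<dots> = (\<Sum>w\<in>nb v. 1 / real (card (nb v)) *
        (\<Sum>W\<in>walks nb k w. \<Prod>i<k. 1 / real (card (nb (W ! i)))))"
      by (simp only: sum_distrib_left)
    also have "\<dots> \<le> (\<Sum>w\<in>nb v. 1 / real (card (nb v)) * 1)"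
      by (intro sum_mono mult_left_mono Suc.IH) auto
    also have "\<dots> \<le> 1" by (cases "card (nb v) = 0") auto
    finally show ?case .
  qed
qed

lemma rotate_injective: "rotate p xs = rotate p ys \<Longrightarrow> xs = ys"
proof (induction p)
  case (Suc p)
  have "rotate1 (rotate p xs) = rotate1 (rotate p ys)"
    using Suc.prems by simp
  then show ?case using Suc.IH inj_rotate1 injD by metis
qed simp

lemma finite_directed_cycles: "finite U \<Longrightarrow> finite (directed_cycles nb l U)"
  by (rule finite_subset[OF _ finite_lists_length_eq[of U l]]) (auto simp: directed_cycles_def)

lemma finite_cycle_tilings: "finite U \<Longrightarrow> finite (cycle_tilings nb l U)"
  by (rule finite_subset[OF _ finite_Pow_iff[THEN iffD2, OF finite_directed_cycles[of U nb l]]])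
    (auto simp: cycle_tilings_def)

text \<open>After rotating the leader to the front, the exposed indices are all except the last one.\<close>

lemma prod_exposed_eq_prod_rotate:
  assumes L: "distinct L" "length L = Suc k" "p < Suc k" and pos: "inj_on pos (set L)"
    and v: "pos (L ! p) = Min (pos ` set L)"
  shows "(\<Prod>i\<in>exposed pos L. g (L ! i)) = (\<Prod>j<k. g (rotate p L ! j))"
proof -
  let ?f = "\<lambda>j. (p + j) mod Suc k"
  have inj: "inj_on ?f {..<Suc k}"
  proof (rule inj_onI)
    have le: "b = a" if "b \<le> a" "a < Suc k" "?f a = ?f b" for a b
    proof -
      have "Suc k dvd a - b"
        using that by (subst (asm) mod_eq_dvd_iff_nat) auto
      then show ?thesis using that by (auto dest!: dvd_imp_le)
    qed
    fix a b assume "a \<in> {..<Suc k}" "b \<in> {..<Suc k}" "?f a = ?f b"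
    then show "a = b" using le[of a b] le[of b a] by (cases "b \<le> a") auto
  qed
  have img: "?f ` {..<Suc k} = {..<Suc k}"
    by (rule card_subset_eq) (auto simp: card_image[OF inj])
  have last: "?f j \<in> exposed pos L \<longleftrightarrow> j \<noteq> k" if j: "j < Suc k" for j
  proof -
    have eq: "Suc (?f j) mod Suc k = ?f (Suc j)"
      by (metis add_Suc_right mod_Suc_eq)
    have "?f j \<in> exposed pos L \<longleftrightarrow> pos (L ! ?f (Suc j)) \<noteq> pos (L ! p)"
      using L v eq by (auto simp: exposed_def)
    also have "\<dots> \<longleftrightarrow> L ! ?f (Suc j) \<noteq> L ! p"
      using pos L by (subst inj_on_eq_iff[OF pos]) auto
    also have "\<dots> \<longleftrightarrow> ?f (Suc j) \<noteq> p"
      using L by (subst nth_eq_iff_index_eq) auto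
    also have "\<dots> \<longleftrightarrow> j \<noteq> k"
    proof (cases "j = k")
      case True
      then have "?f (Suc j) = p" using L(3) by (simp only: mod_add_self2 mod_less)
      then show ?thesis using True by simp
    next
      case False
      then have "Suc j \<in> {..<Suc k}" "0 \<in> {..<Suc k}" using j by auto
      then have "?f (Suc j) \<noteq> ?f 0" using inj_on_eq_iff[OF inj] by blast
      then show ?thesis using False L by simp
    qed
    finally show ?thesis .
  qed
  have "exposed pos L \<subseteq> {..<Suc k}" using L by (auto simp: exposed_def)
  then have "exposed pos L = ?f ` {..<k}"
  proof (intro equalityI subsetI)
    fix i assume i: "i \<in> exposed pos L"
    then obtain j where "j < Suc k" "i = ?f j"
      using \<open>exposed pos L \<subseteq> {..<Suc k}\<close> img by (metis (no_types, lifting) imageE lessThan_iff subsetD)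
    then show "i \<in> ?f ` {..<k}" using i last[of j] by auto
  next
    fix i assume "i \<in> ?f ` {..<k}"
    then show "i \<in> exposed pos L" using last by fastforce
  qed
  then have "(\<Prod>i\<in>exposed pos L. g (L ! i)) = (\<Prod>j<k. g (L ! ?f j))"
    using prod.reindex[OF inj_on_subset[OF inj, of "{..<k}"], of "\<lambda>i. g (L ! i)"] by simp
  also have "\<dots> = (\<Prod>j<k. g (rotate p L ! j))"
    using L by (intro prod.cong) (auto simp: nth_rotate)
  finally show ?thesis .
qed

text \<open>The possible first cycles, i.e. those through the first vertex \<open>v\<close>: the index of \<open>v\<close> together with
  the rotation that starts at \<open>v\<close> determines the list, and the rotation is a walk from \<open>v\<close> inside
  \<open>U\<close>. Each of the \<open>l\<close> indices therefore contributes at most \<open>1 / l\<close>.\<close>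

lemma sum_cycle_weights_le_1:
  assumes "finite U" "inj_on pos U" "v \<in> U" "\<forall>u\<in>U. pos v \<le> pos u" "l \<ge> 1"
  shows "(\<Sum>L\<in>{L \<in> directed_cycles nb l U. v \<in> set L}.
           1 / real l * (\<Prod>i\<in>exposed pos L. 1 / real (card (nb (L ! i) \<inter> U)))) \<le> 1"
proof -
  obtain k where k: "l = Suc k" using assms(5) by (cases l) auto
  define nbU where "nbU u = nb u \<inter> U" for u
  define D where "D = {L \<in> directed_cycles nb l U. v \<in> set L}"
  define leader_index where "leader_index L = (SOME p. p < l \<and> L ! p = v)" for L
  define w where "w W = 1 / real l * (\<Prod>j<k. 1 / real (card (nbU (W ! j))))" for W
  have D: "length L = Suc k" "distinct L" "set L \<subseteq> U" "v \<in> set L"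
      "\<And>i. i < l \<Longrightarrow> L ! (Suc i mod l) \<in> nbU (L ! i)" if "L \<in> D" for L
    using that k by (auto simp: D_def directed_cycles_def nbU_def)
  have leader_index: "leader_index L < l \<and> L ! leader_index L = v" if L: "L \<in> D" for L
    unfolding leader_index_def by (rule someI_ex) (use D[OF L] k in \<open>auto simp: in_set_conv_nth\<close>)
  have Min: "Min (pos ` set L) = pos v" if L: "L \<in> D" for L
    by (rule Min_eqI) (use D[OF L] assms(4) in auto)
  have walk: "rotate (leader_index L) L \<in> walks nbU k v" if L: "L \<in> D" for L
  proof (rule walksI)
    show "length (rotate (leader_index L) L) = Suc k" using D[OF L] by simp
    show "hd (rotate (leader_index L) L) = v"
      using D(1,4)[OF L] leader_index[OF L] k by (subst hd_rotate_conv_nth) auto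
    fix i assume i: "i < k"
    have "L ! (Suc ((leader_index L + i) mod l) mod l) \<in> nbU (L ! ((leader_index L + i) mod l))"
      by (rule D(5)[OF L]) (simp add: k)
    then show "rotate (leader_index L) L ! Suc i \<in> nbU (rotate (leader_index L) L ! i)"
      using D(1)[OF L] i k by (simp add: nth_rotate mod_Suc_eq)
  qed
  have fin: "finite (walks nbU k v)" and le: "(\<Sum>W\<in>walks nbU k v. \<Prod>j<k. 1 / real (card (nbU (W ! j)))) \<le> 1"
    using sum_walks_le_1[of nbU k v] assms(1) by (auto simp: nbU_def)
  have "(\<Sum>L\<in>D. 1 / real l * (\<Prod>i\<in>exposed pos L. 1 / real (card (nbU (L ! i))))) =
      (\<Sum>L\<in>D. w (rotate (leader_index L) L))"
    unfolding w_def
  proof (intro sum.cong arg_cong2[where f = "(*)"] prod_exposed_eq_prod_rotate refl)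
    fix L assume L: "L \<in> D"
    show "inj_on pos (set L)" using assms(2) D(3)[OF L] inj_on_subset by blast
  qed (use D leader_index Min k in auto)
  also have "\<dots> = (\<Sum>(p, W)\<in>(\<lambda>L. (leader_index L, rotate (leader_index L) L)) ` D. w W)"
    by (subst sum.reindex) (auto intro!: inj_onI dest: rotate_injective)
  also have "\<dots> \<le> (\<Sum>(p, W)\<in>{..<l} \<times> walks nbU k v. w W)"
    by (rule sum_mono2) (use fin walk leader_index in \<open>auto simp: w_def prod_nonneg\<close>)
  also have "\<dots> = (\<Sum>W\<in>walks nbU k v. \<Prod>j<k. 1 / real (card (nbU (W ! j))))"
  proof -
    have "(\<Sum>(p, W)\<in>{..<l} \<times> walks nbU k v. w W) = (\<Sum>p<l. \<Sum>W\<in>walks nbU k v. w W)"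
      by (rule sum.cartesian_product[symmetric])
    also have "\<dots> = real l * (1 / real l * (\<Sum>W\<in>walks nbU k v. \<Prod>j<k. 1 / real (card (nbU (W ! j)))))"
      unfolding w_def sum_distrib_left[symmetric] by (simp only: sum_constant card_lessThan mult.left_commute)
    finally show ?thesis using assms(5) by simp
  qed
  finally show ?thesis using le by (simp add: D_def nbU_def)
qed

text \<open>Induction on the uncovered set \<open>U\<close>. The first vertex of \<open>U\<close> leads the cycle that is completed first.
  At that time all of \<open>U\<close> is available, and deleting the cycle leaves a tiling of the rest
  in which the availability of all other cycles is unchanged, so the weight factors.\<close>

lemma sum_tiling_weights_le_1:
  assumes "finite U" "inj_on pos U" "l \<ge> 1"
  shows "(\<Sum>S\<in>cycle_tilings nb l U. tiling_weight nb pos l S) \<le> 1"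
  using assms(1,2)
proof (induction "card U" arbitrary: U rule: less_induct)
  case less
  show ?case
  proof (cases "U = {}")
    case True
    have "cycle_tilings nb l U = {{}}"
      using True assms(3) by (force simp: cycle_tilings_def directed_cycles_def)
    then show ?thesis by (simp add: tiling_weight_def)
  next
    case False
    define v where "v = arg_min_on pos U"
    have v: "v \<in> U" "\<forall>u\<in>U. pos v \<le> pos u"
      using arg_min_if_finite[OF less.prems(1) False, of pos]
      by (auto simp: v_def not_less[symmetric])
    define D where "D = {L \<in> directed_cycles nb l U. v \<in> set L}"
    define w where "w L = 1 / real l * (\<Prod>i\<in>exposed pos L. 1 / real (card (nb (L ! i) \<inter> U)))" for L
    define lead where "lead S = (SOME L. L \<in> S \<and> v \<in> set L)" for S
    have lead: "lead S \<in> S \<and> v \<in> set (lead S)" if "S \<in> cycle_tilings nb l U" for S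
      unfolding lead_def by (rule someI_ex) (use that v in \<open>auto simp: cycle_tilings_def\<close>)
    have leadD: "lead S \<in> D" if "S \<in> cycle_tilings nb l U" for S
      using lead[OF that] that by (auto simp: cycle_tilings_def D_def)
    have rest: "S - {lead S} \<in> cycle_tilings nb l (U - set (lead S))"
      if S: "S \<in> cycle_tilings nb l U" for S
    proof -
      have dis: "set L \<inter> set (lead S) = {}" if "L \<in> S - {lead S}" for L
        using S that lead[OF S] by (auto simp: cycle_tilings_def pairwise_def)
      have "pairwise (\<lambda>L L'. set L \<inter> set L' = {}) (S - {lead S})"
        using S by (auto simp: cycle_tilings_def pairwise_def)
      moreover have "\<Union>(set ` (S - {lead S})) = U - set (lead S)"
      proof -
        have "\<Union>(set ` S) = U" using S by (simp add: cycle_tilings_def)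
        then show ?thesis using dis lead[OF S] by blast
      qed
      moreover have "S - {lead S} \<subseteq> directed_cycles nb l (U - set (lead S))"
      proof
        fix L assume L: "L \<in> S - {lead S}"
        then have "L \<in> directed_cycles nb l U" using S by (auto simp: cycle_tilings_def)
        then show "L \<in> directed_cycles nb l (U - set (lead S))"
          using dis[OF L] by (auto simp: directed_cycles_def)
      qed
      ultimately show ?thesis by (simp add: cycle_tilings_def)
    qed
    have weight: "tiling_weight nb pos l S = w (lead S) * tiling_weight nb pos l (S - {lead S})"
      if S: "S \<in> cycle_tilings nb l U" for S
    proof -
      have fS: "finite S"
        using S finite_directed_cycles[OF less.prems(1), of nb l] finite_subset
        by (auto simp: cycle_tilings_def)
      have cov: "\<Union>(set ` S) = U" using S by (simp add: cycle_tilings_def)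
      have Min_lead: "Min (pos ` set (lead S)) = pos v"
        by (rule Min_eqI) (use lead[OF S] v cov in auto)
      have ge: "pos v \<le> Min (pos ` set L)" if "L \<in> S" for L
      proof -
        have "L \<in> directed_cycles nb l U" using that S by (auto simp: cycle_tilings_def)
        then have "set L \<noteq> {}" "set L \<subseteq> U" using assms(3) by (auto simp: directed_cycles_def)
        then show ?thesis using v(2) by (subst Min_ge_iff) auto
      qed
      have gt: "pos v < Min (pos ` set L)" if L: "L \<in> S - {lead S}" for L
      proof -
        have "set L \<noteq> {}" using L S assms(3) by (auto simp: cycle_tilings_def directed_cycles_def)
        then have "Min (pos ` set L) \<in> pos ` set L" by (intro Min_in) auto
        then obtain x where x: "x \<in> set L" "Min (pos ` set L) = pos x" by auto
        have "x \<noteq> v" using x L lead[OF S] S by (auto simp: cycle_tilings_def pairwise_def)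
        moreover have "x \<in> U" using x L cov by auto
        ultimately have "pos v \<noteq> pos x" using v(1) inj_on_eq_iff[OF less.prems(2)] by blast
        then show ?thesis using x(2) ge[of L] L by simp
      qed
      have "available nb pos S (lead S) u = nb u \<inter> U" for u
        using ge Min_lead cov by (auto simp: available_def)
      moreover have "available nb pos S L u = available nb pos (S - {lead S}) L u" if "L \<in> S - {lead S}" for L u
      proof -
        have "{L' \<in> S. Min (pos ` set L) \<le> Min (pos ` set L')} = {L' \<in> S - {lead S}. Min (pos ` set L) \<le> Min (pos ` set L')}"
          using gt[OF that] Min_lead by auto
        then show ?thesis by (simp add: available_def)
      qed
      ultimately show ?thesis
        unfolding tiling_weight_def w_def using lead[OF S]
        by (subst prod.remove[OF fS, of "lead S"]) auto
    qed
    have finD: "finite D" using finite_directed_cycles[OF less.prems(1), of nb l] by (simp add: D_def)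
    have wnn: "w L \<ge> 0" for L by (simp add: w_def prod_nonneg)
    have tnn: "tiling_weight nb pos l S \<ge> 0" for S
      unfolding tiling_weight_def by (intro prod_nonneg ballI mult_nonneg_nonneg) auto
    have fin: "finite (cycle_tilings nb l (U - A))" for A
      using less.prems(1) by (intro finite_cycle_tilings) auto
    have inj: "inj_on (\<lambda>S. (lead S, S - {lead S})) (cycle_tilings nb l U)"
    proof (rule inj_onI)
      fix S S' assume SS: "S \<in> cycle_tilings nb l U" "S' \<in> cycle_tilings nb l U"
        and "(lead S, S - {lead S}) = (lead S', S' - {lead S'})"
      then have "insert (lead S) (S - {lead S}) = insert (lead S') (S' - {lead S'})"
        by auto
      moreover have "lead S \<in> S" "lead S' \<in> S'" using lead SS by auto
      ultimately show "S = S'" by (metis insert_Diff)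
    qed
    have "(\<Sum>S\<in>cycle_tilings nb l U. tiling_weight nb pos l S) =
        (\<Sum>S\<in>cycle_tilings nb l U. w (lead S) * tiling_weight nb pos l (S - {lead S}))"
      by (rule sum.cong) (use weight in auto)
    also have "\<dots> =
        (\<Sum>(L, S)\<in>(\<lambda>S. (lead S, S - {lead S})) ` cycle_tilings nb l U. w L * tiling_weight nb pos l S)"
      by (simp add: sum.reindex[OF inj])
    also have "\<dots> \<le> (\<Sum>(L, S)\<in>(SIGMA L:D. cycle_tilings nb l (U - set L)). w L * tiling_weight nb pos l S)"
      by (rule sum_mono2) (use finD fin leadD rest wnn tnn in auto)
    also have "\<dots> = (\<Sum>L\<in>D. w L * (\<Sum>S\<in>cycle_tilings nb l (U - set L). tiling_weight nb pos l S))"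
      using finD fin by (subst sum.Sigma[symmetric]) (auto simp: sum_distrib_left)
    also have "\<dots> \<le> (\<Sum>L\<in>D. w L * 1)"
    proof (intro sum_mono mult_left_mono wnn)
      fix L assume "L \<in> D"
      then have "v \<in> set L" by (simp add: D_def)
      then show "(\<Sum>S\<in>cycle_tilings nb l (U - set L). tiling_weight nb pos l S) \<le> 1"
        using less.prems v(1) by (intro less.hyps psubset_card_mono) (auto intro: inj_on_subset)
    qed
    also have "\<dots> \<le> 1"
      using sum_cycle_weights_le_1[OF less.prems v assms(3), of nb] by (simp add: D_def w_def)
    finally show ?thesis .
  qed
qed

section \<open>Random orders of a set partitioned into equal blocks\<close>

text \<open>Ranking the elements of a finite set by an injective key, counted from the largest key.\<close>

lemma bij_betw_count_above:
  fixes f :: "'c \<Rightarrow> nat"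
  assumes "finite A" "inj_on f A"
  shows "bij_betw (\<lambda>x. card {y \<in> A. f x \<le> f y}) A {1..card A}"
proof -
  let ?g = "\<lambda>x. card {y \<in> A. f x \<le> f y}"
  have less: "?g y < ?g x" if "x \<in> A" "y \<in> A" "f x < f y" for x y
  proof (rule psubset_card_mono)
    show "{z \<in> A. f y \<le> f z} \<subset> {z \<in> A. f x \<le> f z}"
    proof
      show "{z \<in> A. f y \<le> f z} \<subseteq> {z \<in> A. f x \<le> f z}" using that by auto
      have "x \<in> {z \<in> A. f x \<le> f z}" "x \<notin> {z \<in> A. f y \<le> f z}" using that by auto
      then show "{z \<in> A. f y \<le> f z} \<noteq> {z \<in> A. f x \<le> f z}" by blast
    qed
  qed (use assms in simp)
  have "inj_on ?g A"
  proof (rule inj_onI)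
    fix x y assume "x \<in> A" "y \<in> A" "?g x = ?g y"
    then have "\<not> f x < f y" "\<not> f y < f x" using less[of x y] less[of y x] by linarith+
    then have "f x = f y" by linarith
    then show "x = y" by (rule inj_onD[OF assms(2)]) fact+
  qed
  moreover have "?g ` A = {1..card A}"
  proof (rule card_subset_eq)
    show "?g ` A \<subseteq> {1..card A}"
    proof (rule image_subsetI)
      fix x assume x: "x \<in> A"
      have "x \<in> {y \<in> A. f x \<le> f y}" using x by simp
      then have "?g x > 0" using assms(1) card_gt_0_iff by fastforce
      moreover have "?g x \<le> card A" by (rule card_mono) (use assms in auto)
      ultimately show "?g x \<in> {1..card A}" by simp
    qed
    show "card (?g ` A) = card {1..card A}" by (simp add: card_image[OF \<open>inj_on ?g A\<close>])
  qed simp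
  ultimately show ?thesis by (simp add: bij_betw_def)
qed

text \<open>A uniformly random order of \<open>V\<close> is modelled as \<open>pos0 \<circ> \<sigma>\<close> with a fixed injection \<open>pos0\<close> and \<open>\<sigma>\<close>
  ranging over all permutations of \<open>V\<close>. Expectations become sums over \<open>\<sigma>\<close>, and every symmetry
  of the partition acts on them by composition from the right.\<close>

locale random_block_order =
  fixes V :: "'b set" and P :: "'b set set" and l :: nat and pos0 :: "'b \<Rightarrow> nat"
  assumes finV: "finite V" and blocks: "\<Union>P = V" "disjoint P" "\<And>B. B \<in> P \<Longrightarrow> card B = l"
    and l: "l \<ge> 1" and pos0: "inj_on pos0 V"
begin

definition orders :: "('b \<Rightarrow> 'b) set" where "orders = {\<sigma>. \<sigma> permutes V}"

definition leader_time :: "('b \<Rightarrow> 'b) \<Rightarrow> 'b set \<Rightarrow> nat" where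
  "leader_time \<sigma> B = Min ((pos0 \<circ> \<sigma>) ` B)"

definition rank :: "('b \<Rightarrow> 'b) \<Rightarrow> 'b set \<Rightarrow> nat" where
  "rank \<sigma> B = card {B' \<in> P. leader_time \<sigma> B \<le> leader_time \<sigma> B'}"

lemma finP: "finite P"
  by (rule finite_UnionD) (simp add: blocks(1) finV)

lemma block_facts: assumes "B \<in> P" shows "finite B" "B \<noteq> {}" "B \<subseteq> V"
proof -
  have "card B > 0" using blocks(3)[OF assms] l by linarith
  then show "finite B" "B \<noteq> {}" by (simp_all add: card_gt_0_iff)
  show "B \<subseteq> V" using blocks(1) assms by blast
qed

lemma sum_orders_shift: "s permutes V \<Longrightarrow> (\<Sum>\<sigma>\<in>orders. f (\<sigma> \<circ> s)) = (\<Sum>\<sigma>\<in>orders. f \<sigma>)"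
  unfolding orders_def by (rule sum_permutations_compose_right[symmetric])

lemma leader_time_compose: "leader_time (\<sigma> \<circ> s) B = leader_time \<sigma> (s ` B)"
  unfolding leader_time_def image_comp comp_assoc ..

lemma rank_compose:
  assumes "bij_betw ((`) s) P P"
  shows "rank (\<sigma> \<circ> s) B = rank \<sigma> (s ` B)"
proof -
  have "bij_betw ((`) s) {A \<in> P. leader_time (\<sigma> \<circ> s) B \<le> leader_time (\<sigma> \<circ> s) A}
      {A \<in> P. leader_time \<sigma> (s ` B) \<le> leader_time \<sigma> A}"
    using assms by (rule bij_betw_Collect) (simp only: leader_time_compose)
  then show ?thesis unfolding rank_def by (rule bij_betw_same_card)
qed

text \<open>Equal block sizes allow two blocks to be exchanged by a permutation that maps blocks to blocks and
  every other block to itself. This symmetry makes the order of the blocks uniform.\<close>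

lemma swap_blocks:
  assumes "A \<in> P" "B \<in> P"
  obtains s where "s permutes V" "s ` A = B" "s ` B = A" "\<forall>D\<in>P - {A, B}. s ` D = D"
    "bij_betw ((`) s) P P"
proof (cases "A = B")
  case True
  show ?thesis by (rule that[of id]) (use True in \<open>auto simp: permutes_id bij_betw_def inj_on_def image_image\<close>)
next
  case False
  have dis: "A \<inter> B = {}" using blocks(2) assms False by (auto simp: disjoint_def)
  obtain f where f: "bij_betw f A B"
    using finite_same_card_bij[of A B] block_facts(1)[OF assms(1)] block_facts(1)[OF assms(2)]
      blocks(3)[OF assms(1)] blocks(3)[OF assms(2)] by auto
  define g where "g = inv_into A f"
  have g: "bij_betw g B A" using f by (simp add: g_def bij_betw_inv_into)
  have gf: "g (f x) = x" if "x \<in> A" for x using that f by (simp add: g_def bij_betw_inv_into_left)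
  have fg: "f (g x) = x" if "x \<in> B" for x using that f by (simp add: g_def bij_betw_inv_into_right)
  define s where "s x = (if x \<in> A then f x else if x \<in> B then g x else x)" for x
  have fB: "f x \<in> B" if "x \<in> A" for x using f that by (auto simp: bij_betw_def)
  have gA: "g x \<in> A" if "x \<in> B" for x using g that by (auto simp: bij_betw_def)
  have ss: "s (s x) = x" for x
    using dis fB[of x] gA[of x] gf[of x] fg[of x] by (auto simp: s_def)
  have "bij s" by (rule o_bij[of s]) (use ss in auto)
  moreover have "s x = x" if "x \<notin> V" for x
    using that block_facts(3)[OF assms(1)] block_facts(3)[OF assms(2)] by (auto simp: s_def)
  ultimately have perm: "s permutes V" unfolding permutes_def bij_iff by blast
  have sA: "s ` A = B" using f by (auto simp: s_def bij_betw_def)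
  have sB: "s ` B = A" unfolding sA[symmetric] image_image by (simp add: ss)
  have sD: "s ` D = D" if "D \<in> P - {A, B}" for D
  proof -
    have "D \<inter> A = {}" "D \<inter> B = {}" using that blocks(2) assms by (auto simp: disjoint_def)
    then have "s x = x" if "x \<in> D" for x using that by (auto simp: s_def)
    then show ?thesis by simp
  qed
  have maps: "s ` D \<in> P" if "D \<in> P" for D
    using that sA sB sD assms by (cases "D = A \<or> D = B") auto
  have "bij_betw ((`) s) P P"
    by (rule bij_betw_byWitness[where f' = "(`) s"]) (use maps ss in \<open>auto simp: image_image\<close>)
  with perm sA sB sD show ?thesis by (intro that ballI)
qed

lemma inj_leader_time: assumes "\<sigma> \<in> orders" shows "inj_on (leader_time \<sigma>) P"
proof (rule inj_onI)
  fix A B assume AB: "A \<in> P" "B \<in> P" "leader_time \<sigma> A = leader_time \<sigma> B"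
  have "leader_time \<sigma> D \<in> (pos0 \<circ> \<sigma>) ` D" if "D \<in> P" for D
    unfolding leader_time_def by (rule Min_in) (use block_facts[OF that] in auto)
  then obtain x y where xy: "x \<in> A" "y \<in> B" "pos0 (\<sigma> x) = pos0 (\<sigma> y)"
    using AB(3) \<open>\<And>D. D \<in> P \<Longrightarrow> leader_time \<sigma> D \<in> (pos0 \<circ> \<sigma>) ` D\<close>[OF AB(1)]
      \<open>\<And>D. D \<in> P \<Longrightarrow> leader_time \<sigma> D \<in> (pos0 \<circ> \<sigma>) ` D\<close>[OF AB(2)] by auto
  have "\<sigma> permutes V" using assms by (simp add: orders_def)
  then have "inj \<sigma>" "\<And>x. \<sigma> x \<in> V \<longleftrightarrow> x \<in> V" by (auto simp: permutes_inj permutes_in_image)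
  moreover from this have "\<sigma> x = \<sigma> y"
    using xy block_facts(3)[OF AB(1)] block_facts(3)[OF AB(2)] by (intro inj_onD[OF pos0]) auto
  ultimately have "x = y" by (simp add: inj_eq)
  then have "A \<inter> B \<noteq> {}" using xy by auto
  then show "A = B" using AB blocks(2) unfolding disjoint_def by blast
qed

lemma rank_bij: "\<sigma> \<in> orders \<Longrightarrow> bij_betw (rank \<sigma>) P {1..card P}"
  unfolding rank_def by (rule bij_betw_count_above[OF finP inj_leader_time])

text \<open>The rank of one block is uniform on \<open>{1..card P}\<close>: all blocks have the same rank distribution
  by symmetry, and for each single order the ranks of all blocks exhaust \<open>{1..card P}\<close>.\<close>

lemma rank_uniform:
  fixes h :: "nat \<Rightarrow> real"
  assumes "B \<in> P"
  shows "real (card P) * (\<Sum>\<sigma>\<in>orders. h (rank \<sigma> B)) = real (card orders) * (\<Sum>j=1..card P. h j)"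
proof -
  have "(\<Sum>\<sigma>\<in>orders. h (rank \<sigma> A)) = (\<Sum>\<sigma>\<in>orders. h (rank \<sigma> B))" if A: "A \<in> P" for A
  proof -
    obtain s where s: "s permutes V" "s ` A = B" "s ` B = A" "\<forall>D\<in>P - {A, B}. s ` D = D"
        "bij_betw ((`) s) P P"
      by (rule swap_blocks[OF A assms])
    show ?thesis
      using sum_orders_shift[OF s(1), of "\<lambda>\<sigma>. h (rank \<sigma> A)"] by (simp only: rank_compose[OF s(5)] s(2))
  qed
  then have "(\<Sum>A\<in>P. \<Sum>\<sigma>\<in>orders. h (rank \<sigma> A)) = (\<Sum>A\<in>P. \<Sum>\<sigma>\<in>orders. h (rank \<sigma> B))"
    by (rule sum.cong[OF refl])
  then have "real (card P) * (\<Sum>\<sigma>\<in>orders. h (rank \<sigma> B)) = (\<Sum>A\<in>P. \<Sum>\<sigma>\<in>orders. h (rank \<sigma> A))"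
    by (simp only: sum_constant)
  also have "\<dots> = (\<Sum>\<sigma>\<in>orders. \<Sum>A\<in>P. h (rank \<sigma> A))" by (rule sum.swap)
  also have "\<dots> = (\<Sum>\<sigma>\<in>orders. \<Sum>j=1..card P. h j)"
    by (intro sum.cong refl sum.reindex_bij_betw rank_bij)
  finally show ?thesis by (simp only: sum_constant)
qed

text \<open>Given the rank \<open>k\<close> of \<open>B\<close>, each of the other \<open>card P - 1\<close> blocks comes later with the same
  probability \<open>(k - 1) / (card P - 1)\<close>: exchanging two of them preserves \<open>B\<close>, and exactly \<open>k - 1\<close>
  of them are later. Testing against an arbitrary function \<open>g\<close> of the rank replaces the conditional
  probability.\<close>

lemma later_uniform:
  fixes g :: "nat \<Rightarrow> real"
  assumes "B \<in> P" "A \<in> P - {B}"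
  shows "real (card P - 1) * (\<Sum>\<sigma>\<in>orders. of_bool (leader_time \<sigma> B < leader_time \<sigma> A) * g (rank \<sigma> B)) =
    (\<Sum>\<sigma>\<in>orders. (real (rank \<sigma> B) - 1) * g (rank \<sigma> B))"
proof -
  let ?T = "\<lambda>A. \<Sum>\<sigma>\<in>orders. of_bool (leader_time \<sigma> B < leader_time \<sigma> A) * g (rank \<sigma> B)"
  have "?T D = ?T A" if D: "D \<in> P - {B}" for D
  proof -
    have DA: "D \<in> P" "A \<in> P" using D assms(2) by auto
    obtain s where s: "s permutes V" "s ` D = A" "s ` A = D" "\<forall>E\<in>P - {D, A}. s ` E = E"
        "bij_betw ((`) s) P P"
      by (rule swap_blocks[OF DA])
    have "s ` B = B" by (rule s(4)[rule_format]) (use assms D in auto)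
    then show ?thesis
      using sum_orders_shift[OF s(1), of "\<lambda>\<sigma>. of_bool (leader_time \<sigma> B < leader_time \<sigma> D) * g (rank \<sigma> B)"]
      by (simp only: rank_compose[OF s(5)] leader_time_compose s(2) \<open>s ` B = B\<close>)
  qed
  then have "(\<Sum>D\<in>P - {B}. ?T D) = (\<Sum>D\<in>P - {B}. ?T A)" by (rule sum.cong[OF refl])
  also have "\<dots> = real (card P - 1) * ?T A"
    using card_Diff_singleton[OF assms(1)] by (simp only: sum_constant)
  finally have "real (card P - 1) * ?T A = (\<Sum>D\<in>P - {B}. ?T D)" by (rule sym)
  also have "\<dots> = (\<Sum>\<sigma>\<in>orders. \<Sum>D\<in>P - {B}. of_bool (leader_time \<sigma> B < leader_time \<sigma> D) * g (rank \<sigma> B))"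
    by (rule sum.swap)
  also have "\<dots> = (\<Sum>\<sigma>\<in>orders. (real (rank \<sigma> B) - 1) * g (rank \<sigma> B))"
  proof (rule sum.cong[OF refl])
    fix \<sigma> assume \<sigma>: "\<sigma> \<in> orders"
    have "{A \<in> P. leader_time \<sigma> B \<le> leader_time \<sigma> A} = insert B {A \<in> P - {B}. leader_time \<sigma> B < leader_time \<sigma> A}"
      using inj_leader_time[OF \<sigma>] assms(1) by (auto simp: inj_on_def order_le_less)
    then have "rank \<sigma> B = Suc (card {A \<in> P - {B}. leader_time \<sigma> B < leader_time \<sigma> A})"
      using finP by (simp add: rank_def)
    moreover have "(\<Sum>D\<in>P - {B}. of_bool (leader_time \<sigma> B < leader_time \<sigma> D)) = real (card {A \<in> P - {B}. leader_time \<sigma> B < leader_time \<sigma> A})"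
      using finP by (simp add: of_bool_def sum.If_cases Int_def)
    ultimately show "(\<Sum>D\<in>P - {B}. of_bool (leader_time \<sigma> B < leader_time \<sigma> D) * g (rank \<sigma> B)) = (real (rank \<sigma> B) - 1) * g (rank \<sigma> B)"
      by (simp add: sum_distrib_right[symmetric])
  qed
  finally show ?thesis .
qed

text \<open>Jensen's inequality conditionally on the rank of \<open>B\<close>. It is applied in the form of the tangent bound
  \<open>ln Y \<le> ln y + (Y - y) / y\<close> at \<open>y\<close>, the conditional mean of \<open>Y\<close>, where the linear term averages to
  zero by \<open>later_uniform\<close>.\<close>

lemma sum_ln_later_le:
  fixes d :: "'b set \<Rightarrow> real" and a D :: real
  assumes B: "B \<in> P" and a: "a > 0" and d: "\<And>A. d A \<ge> 0" and D: "(\<Sum>A\<in>P - {B}. d A) \<le> D"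
  shows "(\<Sum>\<sigma>\<in>orders. ln (a + (\<Sum>A\<in>P - {B}. d A * of_bool (leader_time \<sigma> B < leader_time \<sigma> A)))) \<le>
    real (card orders) * ((\<Sum>j=1..card P. ln (a + D * (real j / real (card P)))) / real (card P))"
proof -
  define r where "r = card P"
  define E where "E = (\<Sum>A\<in>P - {B}. d A)"
  have E: "E \<ge> 0" using d by (simp add: E_def sum_nonneg)
  have r: "r \<ge> 1" using B finP by (auto simp: r_def Suc_le_eq card_gt_0_iff)
  \<comment> \<open>The mean of the argument \<open>Y\<close> of the logarithm, given that \<open>B\<close> has rank \<open>j\<close>; for \<open>r = 1\<close> it is \<open>a\<close>.\<close>
  define y where "y j = a + E * ((real j - 1) / real (r - 1))" for j :: nat
  define Y where "Y \<sigma> = a + (\<Sum>A\<in>P - {B}. d A * of_bool (leader_time \<sigma> B < leader_time \<sigma> A))" for \<sigma>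
  have Ypos: "Y \<sigma> > 0" for \<sigma> using a d by (auto simp: Y_def intro!: add_pos_nonneg sum_nonneg)
  have ypos: "y j > 0" if "j \<ge> 1" for j
    using a E that by (auto simp: y_def intro!: add_pos_nonneg mult_nonneg_nonneg divide_nonneg_nonneg)
  have rank: "rank \<sigma> B \<in> {1..r}" if "\<sigma> \<in> orders" for \<sigma>
    using rank_bij[OF that] B by (auto simp: bij_betw_def r_def)
  have "(\<Sum>\<sigma>\<in>orders. ln (Y \<sigma>)) \<le> (\<Sum>\<sigma>\<in>orders. ln (y (rank \<sigma> B)) + (Y \<sigma> - y (rank \<sigma> B)) * (1 / y (rank \<sigma> B)))"
  proof (rule sum_mono)
    fix \<sigma> assume "\<sigma> \<in> orders"
    then have y: "y (rank \<sigma> B) > 0" using rank ypos by simp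
    have "ln (Y \<sigma> / y (rank \<sigma> B)) \<le> Y \<sigma> / y (rank \<sigma> B) - 1"
      using y Ypos by (intro ln_le_minus_one) simp
    then show "ln (Y \<sigma>) \<le> ln (y (rank \<sigma> B)) + (Y \<sigma> - y (rank \<sigma> B)) * (1 / y (rank \<sigma> B))"
      using y Ypos[of \<sigma>] by (simp add: ln_divide_pos diff_divide_distrib)
  qed
  also have "\<dots> = (\<Sum>\<sigma>\<in>orders. ln (y (rank \<sigma> B)))"
  proof -
    define g where "g j = 1 / y j" for j
    have "(\<Sum>\<sigma>\<in>orders. (Y \<sigma> - a) * g (rank \<sigma> B)) =
        (\<Sum>\<sigma>\<in>orders. \<Sum>A\<in>P - {B}. d A * (of_bool (leader_time \<sigma> B < leader_time \<sigma> A) * g (rank \<sigma> B)))"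
      by (simp add: Y_def sum_distrib_right mult.assoc)
    also have "\<dots> = (\<Sum>A\<in>P - {B}. d A * (\<Sum>\<sigma>\<in>orders. of_bool (leader_time \<sigma> B < leader_time \<sigma> A) * g (rank \<sigma> B)))"
      by (subst sum.swap) (simp only: sum_distrib_left)
    also have "\<dots> = (\<Sum>A\<in>P - {B}. d A * ((\<Sum>\<sigma>\<in>orders. (real (rank \<sigma> B) - 1) * g (rank \<sigma> B)) / real (r - 1)))"
    proof (intro sum.cong refl arg_cong2[where f = "(*)"])
      fix A assume A: "A \<in> P - {B}"
      then have "card {A, B} \<le> r" using finP B unfolding r_def by (intro card_mono) auto
      then have "real (r - 1) > 0" using A by auto
      then show "(\<Sum>\<sigma>\<in>orders. of_bool (leader_time \<sigma> B < leader_time \<sigma> A) * g (rank \<sigma> B)) =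
         (\<Sum>\<sigma>\<in>orders. (real (rank \<sigma> B) - 1) * g (rank \<sigma> B)) / real (r - 1)"
        using later_uniform[OF B A, of g] by (simp add: r_def field_simps)
    qed
    also have "\<dots> = E * ((\<Sum>\<sigma>\<in>orders. (real (rank \<sigma> B) - 1) * g (rank \<sigma> B)) / real (r - 1))"
      by (simp only: sum_distrib_right E_def)
    also have "\<dots> = (\<Sum>\<sigma>\<in>orders. (y (rank \<sigma> B) - a) * g (rank \<sigma> B))"
      by (simp add: y_def sum_distrib_left sum_divide_distrib mult.assoc)
    finally have "(\<Sum>\<sigma>\<in>orders. (Y \<sigma> - y (rank \<sigma> B)) * g (rank \<sigma> B)) = 0"
      by (simp add: left_diff_distrib sum_subtractf)
    then show ?thesis by (simp add: sum.distrib g_def)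
  qed
  also have "\<dots> = real (card orders) * ((\<Sum>j=1..r. ln (y j)) / real r)"
    using rank_uniform[OF B, of "\<lambda>j. ln (y j)"] r by (simp add: r_def field_simps)
  also have "\<dots> \<le> real (card orders) * ((\<Sum>j=1..r. ln (a + D * (real j / real r))) / real r)"
  proof (intro mult_left_mono divide_right_mono sum_mono ln_mono)
    fix j assume j: "j \<in> {1..r}"
    have "(real j - 1) / real (r - 1) \<le> real j / real r"
      using j by (cases "r = 1") (auto simp: field_simps of_nat_diff)
    then have "E * ((real j - 1) / real (r - 1)) \<le> D * (real j / real r)"
      using D E j by (intro mult_mono) (auto simp: E_def)
    then show "y j \<le> a + D * (real j / real r)" by (simp add: y_def)
    show "0 < y j" using ypos j by simp
  qed auto
  finally show ?thesis by (simp add: Y_def r_def)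
qed

text \<open>Transposing two vertices of \<open>B\<close> changes neither the order of the blocks nor the value of the
  logarithm, so all \<open>l\<close> vertices of \<open>B\<close> contribute equally to the event of leading \<open>B\<close>, and
  excluding this event for \<open>x\<close> costs exactly the fraction \<open>1 / l\<close>.\<close>

lemma sum_ln_later_not_first_le:
  fixes d :: "'b set \<Rightarrow> real" and a D :: real
  assumes B: "B \<in> P" and x: "x \<in> B" and a: "a > 0" and d: "\<And>A. d A \<ge> 0" and D: "(\<Sum>A\<in>P - {B}. d A) \<le> D"
  shows "(\<Sum>\<sigma>\<in>orders. of_bool (pos0 (\<sigma> x) \<noteq> leader_time \<sigma> B) *
      ln (a + (\<Sum>A\<in>P - {B}. d A * of_bool (leader_time \<sigma> B < leader_time \<sigma> A)))) \<le>
    (1 - 1 / real l) * (real (card orders) *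
      ((\<Sum>j=1..card P. ln (a + D * (real j / real (card P)))) / real (card P)))"
proof -
  define h where "h \<sigma> = ln (a + (\<Sum>A\<in>P - {B}. d A * of_bool (leader_time \<sigma> B < leader_time \<sigma> A)))" for \<sigma>
  let ?T = "\<lambda>x. \<Sum>\<sigma>\<in>orders. of_bool (pos0 (\<sigma> x) = leader_time \<sigma> B) * h \<sigma>"
  have "?T z = ?T x" if z: "z \<in> B" for z
  proof -
    let ?s = "transpose x z"
    have s: "?s permutes V" using z x block_facts(3)[OF B] by (intro permutes_swap_id) auto
    have sA: "?s ` A = A" if "A \<in> P" for A
    proof -
      have "(x \<in> A \<longleftrightarrow> z \<in> A)" using blocks(2) that B x z by (auto simp: disjoint_def)
      then show ?thesis by simp
    qed
    have "h (\<sigma> \<circ> ?s) = h \<sigma>" for \<sigma>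
    proof -
      have "(\<Sum>A\<in>P - {B}. d A * of_bool (leader_time (\<sigma> \<circ> ?s) B < leader_time (\<sigma> \<circ> ?s) A)) =
          (\<Sum>A\<in>P - {B}. d A * of_bool (leader_time \<sigma> B < leader_time \<sigma> A))"
        unfolding leader_time_compose by (rule sum.cong[OF refl]) (simp only: sA B DiffD1)
      then show ?thesis by (simp only: h_def)
    qed
    then show ?thesis
      using sum_orders_shift[OF s, of "\<lambda>\<sigma>. of_bool (pos0 (\<sigma> z) = leader_time \<sigma> B) * h \<sigma>"]
      by (simp add: leader_time_compose sA[OF B])
  qed
  then have "(\<Sum>z\<in>B. ?T z) = (\<Sum>z\<in>B. ?T x)" by (rule sum.cong[OF refl])
  then have "real l * ?T x = (\<Sum>z\<in>B. ?T z)" by (simp only: sum_constant blocks(3)[OF B])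
  also have "\<dots> = (\<Sum>\<sigma>\<in>orders. \<Sum>z\<in>B. of_bool (pos0 (\<sigma> z) = leader_time \<sigma> B) * h \<sigma>)"
    by (rule sum.swap)
  also have "\<dots> = (\<Sum>\<sigma>\<in>orders. h \<sigma>)"
  proof (rule sum.cong[OF refl])
    fix \<sigma> assume "\<sigma> \<in> orders"
    then have \<sigma>: "inj \<sigma>" "\<And>x. \<sigma> x \<in> V \<longleftrightarrow> x \<in> V"
      by (auto simp: orders_def permutes_inj permutes_in_image)
    have "leader_time \<sigma> B \<in> (pos0 \<circ> \<sigma>) ` B"
      unfolding leader_time_def by (rule Min_in) (use block_facts[OF B] in auto)
    then obtain z where z: "z \<in> B" "leader_time \<sigma> B = pos0 (\<sigma> z)" by auto
    have "{w \<in> B. pos0 (\<sigma> w) = leader_time \<sigma> B} = {z}"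
    proof (intro equalityI subsetI)
      fix w assume "w \<in> {w \<in> B. pos0 (\<sigma> w) = leader_time \<sigma> B}"
      then have w: "w \<in> B" "pos0 (\<sigma> w) = pos0 (\<sigma> z)" using z by auto
      then have "\<sigma> w = \<sigma> z"
        using z(1) block_facts(3)[OF B] \<sigma>(2) by (intro inj_onD[OF pos0]) auto
      then show "w \<in> {z}" using \<sigma>(1) by (simp add: inj_eq)
    qed (use z in auto)
    then have "(\<Sum>z\<in>B. of_bool (pos0 (\<sigma> z) = leader_time \<sigma> B)) = (1::real)"
      using block_facts(1)[OF B] by (simp add: of_bool_def sum.If_cases Int_def)
    then show "(\<Sum>z\<in>B. of_bool (pos0 (\<sigma> z) = leader_time \<sigma> B) * h \<sigma>) = h \<sigma>"
      by (simp add: sum_distrib_right[symmetric])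
  qed
  finally have T: "?T x = (\<Sum>\<sigma>\<in>orders. h \<sigma>) / real l" using l by (simp add: field_simps)
  have "(\<Sum>\<sigma>\<in>orders. of_bool (pos0 (\<sigma> x) \<noteq> leader_time \<sigma> B) * h \<sigma>) = (\<Sum>\<sigma>\<in>orders. h \<sigma>) - ?T x"
    unfolding sum_subtractf[symmetric] by (intro sum.cong) auto
  also have "\<dots> = (1 - 1 / real l) * (\<Sum>\<sigma>\<in>orders. h \<sigma>)" by (simp add: T left_diff_distrib)
  also have "\<dots> \<le> (1 - 1 / real l) * (real (card orders) *
      ((\<Sum>j=1..card P. ln (a + D * (real j / real (card P)))) / real (card P)))"
    using sum_ln_later_le[OF B a d D] l unfolding h_def by (intro mult_left_mono) auto
  finally show ?thesis by (simp add: h_def)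
qed

end

section \<open>The number of cycle tilings\<close>

lemma cycle_tiling_facts:
  assumes "S \<in> cycle_tilings nb l V" "finite V" "l \<ge> 1"
  shows "finite S" "inj_on set S" "disjoint (set ` S)" "\<Union>(set ` S) = V"
    "\<And>L. L \<in> S \<Longrightarrow> length L = l" "\<And>L. L \<in> S \<Longrightarrow> distinct L" "\<And>L. L \<in> S \<Longrightarrow> card (set L) = l"
    "\<And>L i. L \<in> S \<Longrightarrow> i < l \<Longrightarrow> L ! (Suc i mod l) \<in> nb (L ! i)"
    "\<And>f :: 'b \<Rightarrow> real. (\<Sum>L\<in>S. \<Sum>i<l. f (L ! i)) = (\<Sum>u\<in>V. f u)"
    "card V = l * card S"
proof -
  have D: "S \<subseteq> directed_cycles nb l V" "pairwise (\<lambda>L L'. set L \<inter> set L' = {}) S"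
    and cov: "\<Union>(set ` S) = V"
    using assms(1) by (auto simp: cycle_tilings_def)
  show fin: "finite S" using D(1) finite_directed_cycles[OF assms(2)] by (rule finite_subset)
  show len: "length L = l" and dis: "distinct L" if "L \<in> S" for L
    using D(1) that by (auto simp: directed_cycles_def)
  show "L ! (Suc i mod l) \<in> nb (L ! i)" if "L \<in> S" "i < l" for L i
    using D(1) that by (auto simp: directed_cycles_def)
  show card: "card (set L) = l" if "L \<in> S" for L
    using len[OF that] dis[OF that] by (simp add: distinct_card)
  have disj: "set L \<inter> set L' = {}" if "L \<in> S" "L' \<in> S" "L \<noteq> L'" for L L'
    using pairwiseD[OF D(2) that] .
  show inj: "inj_on set S"
  proof (rule inj_onI, rule ccontr)
    fix L L' assume "L \<in> S" "L' \<in> S" and eq: "set L = set L'" and "L \<noteq> L'"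
    then have "set L \<inter> set L' = {}" by (intro disj)
    then have "card (set L) = 0" using eq by simp
    then show False using card[OF \<open>L \<in> S\<close>] assms(3) by linarith
  qed
  show "disjoint (set ` S)"
  proof (rule disjointI)
    fix A B assume "A \<in> set ` S" "B \<in> set ` S" "A \<noteq> B"
    then show "A \<inter> B = {}" using disj by blast
  qed
  show "\<Union>(set ` S) = V" by (rule cov)
  show sums: "(\<Sum>L\<in>S. \<Sum>i<l. f (L ! i)) = (\<Sum>u\<in>V. f u)" for f :: "'b \<Rightarrow> real"
  proof -
    have "(\<Sum>L\<in>S. \<Sum>i<l. f (L ! i)) = (\<Sum>L\<in>S. \<Sum>u\<in>set L. f u)"
      by (intro sum.cong refl sum.reindex_bij_betw bij_betw_nth) (use len dis in auto)
    also have "\<dots> = (\<Sum>u\<in>\<Union>(set ` S). f u)"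
    proof (rule sum.UNION_disjoint[symmetric])
      show "\<forall>L\<in>S. \<forall>L'\<in>S. L \<noteq> L' \<longrightarrow> set L \<inter> set L' = {}"
        by (intro ballI impI disj)
    qed (use fin in simp_all)
    finally show ?thesis by (simp only: cov)
  qed
  have "real (card V) = real (l * card S)"
    using sums[of "\<lambda>_. 1"] by (simp only: sum_constant card_lessThan of_nat_mult mult_1_left mult_1_right mult.commute)
  then show "card V = l * card S" by (simp only: of_nat_eq_iff)
qed

text \<open>Concavity of \<open>ln\<close>, or equivalently that the entropy of the uniform distribution is at most its
  cross entropy relative to \<open>q\<close>.\<close>

lemma ln_card_le_average_neg_ln:
  fixes q :: "'c \<Rightarrow> real"
  assumes "finite T" "T \<noteq> {}" "\<And>S. S \<in> T \<Longrightarrow> q S > 0" "(\<Sum>S\<in>T. q S) \<le> 1"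
  shows "real (card T) * ln (real (card T)) \<le> (\<Sum>S\<in>T. - ln (q S))"
proof -
  have N: "real (card T) > 0" using assms by (simp add: card_gt_0_iff)
  have "(\<Sum>S\<in>T. ln (q S) + ln (real (card T))) \<le> (\<Sum>S\<in>T. q S * real (card T) - 1)"
  proof (rule sum_mono)
    fix S assume "S \<in> T"
    then show "ln (q S) + ln (real (card T)) \<le> q S * real (card T) - 1"
      using ln_le_minus_one[of "q S * real (card T)"] assms(3) N by (simp add: ln_mult_pos)
  qed
  also have "\<dots> = (\<Sum>S\<in>T. q S) * real (card T) - real (card T)"
    by (simp add: sum_subtractf sum_distrib_right)
  also have "\<dots> \<le> 0" using mult_right_mono[OF assms(4), of "real (card T)"] N by simp
  finally show ?thesis by (simp add: sum.distrib sum_negf)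
qed

text \<open>The successor of a vertex in its own cycle is available, so the logarithms in the weight
  are nonnegative. For the upper bound all \<open>l\<close> vertices of the current cycle are counted as available,
  which leaves a sum over the later blocks as in \<open>sum_ln_later_le\<close>.\<close>

lemma available_bounds:
  assumes S: "S \<in> cycle_tilings nb l V" and V: "finite V" and l: "l \<ge> 1" and L: "L \<in> S"
  shows "i < l \<Longrightarrow> card (available nb pos S L (L ! i)) \<ge> 1"
    and "inj_on (\<lambda>B. Min (pos ` B)) (set ` S) \<Longrightarrow>
      real (card (available nb pos S L u)) \<le> real l + (\<Sum>B\<in>set ` S - {set L}.
        real (card (nb u \<inter> B)) * of_bool (Min (pos ` set L) < Min (pos ` B)))"
proof -
  note T = cycle_tiling_facts[OF S V l]
  have fin: "finite (available nb pos S L u)" for u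
    by (rule finite_subset[OF _ V]) (use T(4) in \<open>auto simp: available_def\<close>)
  show "card (available nb pos S L (L ! i)) \<ge> 1" if i: "i < l"
  proof -
    have "Suc i mod l < length L" using i T(5)[OF L] by simp
    then have "L ! (Suc i mod l) \<in> set L" by (rule nth_mem)
    then have "L ! (Suc i mod l) \<in> available nb pos S L (L ! i)"
      using T(8)[OF L i] L by (auto simp: available_def)
    then have "card (available nb pos S L (L ! i)) \<noteq> 0" using fin by auto
    then show ?thesis by linarith
  qed
  let ?R = "{B \<in> set ` S - {set L}. Min (pos ` set L) < Min (pos ` B)}"
  show "real (card (available nb pos S L u)) \<le> real l + (\<Sum>B\<in>set ` S - {set L}.
        real (card (nb u \<inter> B)) * of_bool (Min (pos ` set L) < Min (pos ` B)))"
    if inj: "inj_on (\<lambda>B. Min (pos ` B)) (set ` S)"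
  proof -
    have "available nb pos S L u \<subseteq> set L \<union> (\<Union>B\<in>?R. nb u \<inter> B)"
    proof
      fix w assume "w \<in> available nb pos S L u"
      then obtain L' where w: "w \<in> nb u" "L' \<in> S" "w \<in> set L'" "Min (pos ` set L) \<le> Min (pos ` set L')"
        by (auto simp: available_def)
      show "w \<in> set L \<union> (\<Union>B\<in>?R. nb u \<inter> B)"
      proof (cases "set L' = set L")
        case False
        then have "Min (pos ` set L) \<noteq> Min (pos ` set L')"
          using inj_onD[OF inj] L w(2) by blast
        then have "set L' \<in> ?R" using w False by auto
        then show ?thesis using w by blast
      qed (use w in auto)
    qed
    moreover have finS: "finite (set ` S)" using T(1) by simp
    moreover have "finite (set L \<union> (\<Union>B\<in>?R. nb u \<inter> B))"
      by (rule finite_subset[OF _ V]) (use T(4) L in auto)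
    ultimately have "card (available nb pos S L u) \<le> card (set L \<union> (\<Union>B\<in>?R. nb u \<inter> B))"
      by (intro card_mono)
    also have "\<dots> \<le> card (set L) + card (\<Union>B\<in>?R. nb u \<inter> B)" by (rule card_Un_le)
    also have "\<dots> \<le> l + (\<Sum>B\<in>?R. card (nb u \<inter> B))"
    proof (rule add_mono)
      show "card (set L) \<le> l" using T(7)[OF L] by simp
      show "card (\<Union>B\<in>?R. nb u \<inter> B) \<le> (\<Sum>B\<in>?R. card (nb u \<inter> B))"
        by (rule card_UN_le) (use finS in simp)
    qed
    finally have "real (card (available nb pos S L u)) \<le> real (l + (\<Sum>B\<in>?R. card (nb u \<inter> B)))"
      by (simp only: of_nat_le_iff)
    also have "\<dots> = real l + (\<Sum>B\<in>?R. real (card (nb u \<inter> B)))"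
      by (simp only: of_nat_add of_nat_sum)
    also have "(\<Sum>B\<in>?R. real (card (nb u \<inter> B))) = (\<Sum>B\<in>set ` S - {set L}.
        if Min (pos ` set L) < Min (pos ` B) then real (card (nb u \<inter> B)) else 0)"
      by (rule sum.inter_filter) (use finS in simp)
    also have "\<dots> = (\<Sum>B\<in>set ` S - {set L}.
        real (card (nb u \<inter> B)) * of_bool (Min (pos ` set L) < Min (pos ` B)))"
      by (intro sum.cong) auto
    finally show ?thesis .
  qed
qed

lemma neg_ln_tiling_weight:
  assumes S: "S \<in> cycle_tilings nb l V" and V: "finite V" and l: "l \<ge> 1"
  shows "tiling_weight nb pos l S > 0"
    "- ln (tiling_weight nb pos l S) = real (card S) * ln (real l) +
      (\<Sum>L\<in>S. \<Sum>i<l. of_bool (pos (L ! (Suc i mod l)) \<noteq> Min (pos ` set L)) *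
        ln (real (card (available nb pos S L (L ! i)))))"
proof -
  note T = cycle_tiling_facts[OF S V l]
  have ex: "exposed pos L = {i \<in> {..<l}. pos (L ! (Suc i mod l)) \<noteq> Min (pos ` set L)}" if "L \<in> S" for L
    using T(5)[OF that] by (auto simp: exposed_def)
  define A where "A L i = real (card (available nb pos S L (L ! i)))" for L i
  have A: "A L i > 0" if "L \<in> S" "i \<in> exposed pos L" for L i
    using available_bounds(1)[OF S V l that(1), of i pos] that ex[OF that(1)] by (auto simp: A_def)
  have P: "(\<Prod>i\<in>exposed pos L. 1 / A L i) > 0" if "L \<in> S" for L
    by (rule prod_pos) (use A that in auto)
  have W: "tiling_weight nb pos l S = (\<Prod>L\<in>S. 1 / real l * (\<Prod>i\<in>exposed pos L. 1 / A L i))"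
    by (simp add: tiling_weight_def A_def)
  have Lpos: "1 / real l * (\<Prod>i\<in>exposed pos L. 1 / A L i) > 0" if "L \<in> S" for L
    using P[OF that] l by (intro mult_pos_pos) auto
  show "tiling_weight nb pos l S > 0" unfolding W by (rule prod_pos) (rule Lpos)
  have "- ln (tiling_weight nb pos l S) = - (\<Sum>L\<in>S. ln (1 / real l * (\<Prod>i\<in>exposed pos L. 1 / A L i)))"
  proof -
    have nz: "1 / real l * (\<Prod>i\<in>exposed pos L. 1 / A L i) \<noteq> 0" if "L \<in> S" for L
      using Lpos[OF that] by linarith
    show ?thesis by (simp only: W ln_prod[OF T(1) nz])
  qed
  also have "\<dots> = (\<Sum>L\<in>S. ln (real l) + (\<Sum>i<l. of_bool (pos (L ! (Suc i mod l)) \<noteq> Min (pos ` set L)) * ln (A L i)))"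
    unfolding sum_negf[symmetric]
  proof (rule sum.cong[OF refl])
    fix L assume L: "L \<in> S"
    have "ln (1 / real l * (\<Prod>i\<in>exposed pos L. 1 / A L i)) = ln (1 / real l) + ln (\<Prod>i\<in>exposed pos L. 1 / A L i)"
      using P[OF L] l by (intro ln_mult_pos) auto
    also have "ln (\<Prod>i\<in>exposed pos L. 1 / A L i) = (\<Sum>i\<in>exposed pos L. ln (1 / A L i))"
    proof (rule ln_prod)
      show "1 / A L i \<noteq> 0" if "i \<in> exposed pos L" for i using A[OF L that] by simp
    qed (simp add: ex[OF L])
    also have "\<dots> = (\<Sum>i\<in>exposed pos L. - ln (A L i))"
      by (rule sum.cong) (use A[OF L] in \<open>auto simp: ln_divide_pos\<close>)
    also have "\<dots> = - (\<Sum>i<l. if pos (L ! (Suc i mod l)) \<noteq> Min (pos ` set L) then ln (A L i) else 0)"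
      unfolding sum_negf ex[OF L] by (subst sum.inter_filter) auto
    also have "(\<Sum>i<l. if pos (L ! (Suc i mod l)) \<noteq> Min (pos ` set L) then ln (A L i) else 0) =
        (\<Sum>i<l. of_bool (pos (L ! (Suc i mod l)) \<noteq> Min (pos ` set L)) * ln (A L i))"
      by (intro sum.cong) auto
    finally show "- ln (1 / real l * (\<Prod>i\<in>exposed pos L. 1 / A L i)) =
        ln (real l) + (\<Sum>i<l. of_bool (pos (L ! (Suc i mod l)) \<noteq> Min (pos ` set L)) * ln (A L i))"
      using l by (simp add: ln_divide_pos)
  qed
  finally show "- ln (tiling_weight nb pos l S) = real (card S) * ln (real l) +
      (\<Sum>L\<in>S. \<Sum>i<l. of_bool (pos (L ! (Suc i mod l)) \<noteq> Min (pos ` set L)) *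
        ln (real (card (available nb pos S L (L ! i)))))"
    by (simp add: sum.distrib A_def)
qed

text \<open>The weight inequality holds for each order \<open>\<sigma>\<close>. Summing it over all orders and interchanging
  the two sums leaves, for each fixed tiling, an average over random orders of the blocks of
  that tiling.\<close>

lemma ln_card_cycle_tilings_le:
  fixes V :: "'b set"
  assumes V: "finite V" and l: "l \<ge> 1" and r: "card V = l * r" and ne: "cycle_tilings nb l V \<noteq> {}"
  shows "ln (real (card (cycle_tilings nb l V))) \<le> real r * ln (real l) + (1 - 1 / real l) *
    (\<Sum>u\<in>V. (\<Sum>j=1..r. ln (real l + real (card (nb u \<inter> V)) * (real j / real r))) / real r)"
proof -
  define T where "T = cycle_tilings nb l V"
  define Q where "Q = {\<sigma>. \<sigma> permutes V}"
  define \<phi> where "\<phi> u = (\<Sum>j=1..r. ln (real l + real (card (nb u \<inter> V)) * (real j / real r))) / real r" for u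
  define m where "m = real (card Q)"
  obtain pos0 :: "'b \<Rightarrow> nat" where pos0: "inj_on pos0 V"
    using finite_imp_inj_to_nat_seg[OF V] by blast
  have "id \<in> Q" by (simp add: Q_def permutes_id)
  moreover have "finite Q" unfolding Q_def by (rule finite_permutations[OF V])
  ultimately have m: "m > 0" unfolding m_def of_nat_0_less_iff card_gt_0_iff by blast
  have finT: "finite T" using V by (simp add: T_def finite_cycle_tilings)
  then have N: "real (card T) > 0" using ne by (simp add: T_def card_gt_0_iff)
  define q where "q \<sigma> S = - ln (tiling_weight nb (pos0 \<circ> \<sigma>) l S)" for \<sigma> S
  have per_order: "real (card T) * ln (real (card T)) \<le> (\<Sum>S\<in>T. q \<sigma> S)" if "\<sigma> \<in> Q" for \<sigma>
  proof -
    have \<sigma>: "\<sigma> permutes V" using that by (simp add: Q_def)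
    have "inj_on (pos0 \<circ> \<sigma>) V"
      using pos0 permutes_image[OF \<sigma>] permutes_inj_on[OF \<sigma>, of V] by (intro comp_inj_on) auto
    then have "(\<Sum>S\<in>T. tiling_weight nb (pos0 \<circ> \<sigma>) l S) \<le> 1"
      unfolding T_def by (rule sum_tiling_weights_le_1[OF V _ l])
    moreover have "tiling_weight nb (pos0 \<circ> \<sigma>) l S > 0" if "S \<in> T" for S
      using neg_ln_tiling_weight(1)[OF _ V l] that by (simp add: T_def)
    ultimately show ?thesis
      unfolding q_def using finT ne by (intro ln_card_le_average_neg_ln) (auto simp: T_def)
  qed
  have per_tiling: "(\<Sum>\<sigma>\<in>Q. q \<sigma> S) \<le> m * (real r * ln (real l) + (1 - 1 / real l) * (\<Sum>u\<in>V. \<phi> u))"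
    if "S \<in> T" for S
  proof -
    have S: "S \<in> cycle_tilings nb l V" using that by (simp add: T_def)
    note C = cycle_tiling_facts[OF S V l]
    have rS: "card S = r" using C(10) r l by simp
    have rP: "card (set ` S) = r" using card_image[OF C(2)] rS by simp
    interpret random_block_order V "set ` S" l pos0
      by unfold_locales (use V C l pos0 in auto)
    have Q: "Q = orders" by (simp add: Q_def orders_def)
    define Y where "Y \<sigma> L u = real l + (\<Sum>B\<in>set ` S - {set L}. real (card (nb u \<inter> B)) * of_bool (leader_time \<sigma> (set L) < leader_time \<sigma> B))"
      for \<sigma> L u
    have "(\<Sum>\<sigma>\<in>Q. q \<sigma> S) \<le> (\<Sum>\<sigma>\<in>Q. real r * ln (real l) +
        (\<Sum>L\<in>S. \<Sum>i<l. of_bool (pos0 (\<sigma> (L ! (Suc i mod l))) \<noteq> leader_time \<sigma> (set L)) * ln (Y \<sigma> L (L ! i))))"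
    proof (rule sum_mono)
      fix \<sigma> assume \<sigma>: "\<sigma> \<in> Q"
      have inj: "inj_on (\<lambda>B. Min ((pos0 \<circ> \<sigma>) ` B)) (set ` S)"
        using inj_leader_time[of \<sigma>] \<sigma> unfolding Q leader_time_def by simp
      have "ln (real (card (available nb (pos0 \<circ> \<sigma>) S L (L ! i)))) \<le> ln (Y \<sigma> L (L ! i))"
        if L: "L \<in> S" and i: "i < l" for L i
        using available_bounds(1)[OF S V l L i, of "pos0 \<circ> \<sigma>"]
          available_bounds(2)[OF S V l L inj, of "L ! i"]
        by (intro ln_mono) (auto simp: Y_def leader_time_def)
      then show "q \<sigma> S \<le> real r * ln (real l) +
        (\<Sum>L\<in>S. \<Sum>i<l. of_bool (pos0 (\<sigma> (L ! (Suc i mod l))) \<noteq> leader_time \<sigma> (set L)) * ln (Y \<sigma> L (L ! i)))"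
        unfolding q_def neg_ln_tiling_weight(2)[OF S V l] rS leader_time_def comp_apply
        by (intro add_left_mono sum_mono mult_left_mono) auto
    qed
    also have "\<dots> = m * (real r * ln (real l)) + (\<Sum>\<sigma>\<in>Q. \<Sum>L\<in>S. \<Sum>i<l.
        of_bool (pos0 (\<sigma> (L ! (Suc i mod l))) \<noteq> leader_time \<sigma> (set L)) * ln (Y \<sigma> L (L ! i)))"
      by (simp only: sum.distrib sum_constant m_def)
    also have "(\<Sum>\<sigma>\<in>Q. \<Sum>L\<in>S. \<Sum>i<l.
          of_bool (pos0 (\<sigma> (L ! (Suc i mod l))) \<noteq> leader_time \<sigma> (set L)) * ln (Y \<sigma> L (L ! i))) =
        (\<Sum>L\<in>S. \<Sum>i<l. \<Sum>\<sigma>\<in>Q.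
          of_bool (pos0 (\<sigma> (L ! (Suc i mod l))) \<noteq> leader_time \<sigma> (set L)) * ln (Y \<sigma> L (L ! i)))"
      by (subst sum.swap, rule sum.cong[OF refl], rule sum.swap)
    also have "\<dots> \<le> (\<Sum>L\<in>S. \<Sum>i<l. (1 - 1 / real l) * (m * \<phi> (L ! i)))"
    proof (intro sum_mono)
      fix L i assume L: "L \<in> S" and i: "i \<in> {..<l}"
      let ?u = "L ! i"
      have x: "L ! (Suc i mod l) \<in> set L" using C(5)[OF L] i by (intro nth_mem) auto
      have "(\<Sum>B\<in>set ` S - {set L}. real (card (nb ?u \<inter> B))) \<le> (\<Sum>B\<in>set ` S. real (card (nb ?u \<inter> B)))"
        by (rule sum_mono2) (use C(1) in auto)
      also have "\<dots> = real (\<Sum>B\<in>set ` S. card (nb ?u \<inter> B))" by simp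
      also have "(\<Sum>B\<in>set ` S. card (nb ?u \<inter> B)) = card (\<Union>B\<in>set ` S. nb ?u \<inter> B)"
        by (rule card_UN_disjoint[symmetric]) (use C(1,3) in \<open>auto simp: disjoint_def\<close>)
      also have "(\<Union>B\<in>set ` S. nb ?u \<inter> B) = nb ?u \<inter> V" using C(4) by auto
      finally have D: "(\<Sum>B\<in>set ` S - {set L}. real (card (nb ?u \<inter> B))) \<le> real (card (nb ?u \<inter> V))" .
      show "(\<Sum>\<sigma>\<in>Q. of_bool (pos0 (\<sigma> (L ! (Suc i mod l))) \<noteq> leader_time \<sigma> (set L)) * ln (Y \<sigma> L ?u))
          \<le> (1 - 1 / real l) * (m * \<phi> ?u)"
        using sum_ln_later_not_first_le[OF _ x _ _ D, of "real l"] L l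
        unfolding Q m_def \<phi>_def Y_def rP by simp
    qed
    also have "\<dots> = (1 - 1 / real l) * (m * (\<Sum>u\<in>V. \<phi> u))"
      unfolding C(9)[of \<phi>, symmetric] sum_distrib_left ..
    finally show ?thesis by (simp add: algebra_simps)
  qed
  have "m * (real (card T) * ln (real (card T))) = (\<Sum>\<sigma>\<in>Q. real (card T) * ln (real (card T)))"
    by (simp add: m_def)
  also have "\<dots> \<le> (\<Sum>\<sigma>\<in>Q. \<Sum>S\<in>T. q \<sigma> S)" by (rule sum_mono) (rule per_order)
  also have "\<dots> = (\<Sum>S\<in>T. \<Sum>\<sigma>\<in>Q. q \<sigma> S)" by (rule sum.swap)
  also have "\<dots> \<le> (\<Sum>S\<in>T. m * (real r * ln (real l) + (1 - 1 / real l) * (\<Sum>u\<in>V. \<phi> u)))"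
    by (rule sum_mono) (rule per_tiling)
  also have "\<dots> = (m * real (card T)) * (real r * ln (real l) + (1 - 1 / real l) * (\<Sum>u\<in>V. \<phi> u))"
    by simp
  finally have "(m * real (card T)) * ln (real (card T)) \<le>
      (m * real (card T)) * (real r * ln (real l) + (1 - 1 / real l) * (\<Sum>u\<in>V. \<phi> u))"
    by (simp only: mult.assoc)
  then have "ln (real (card T)) \<le> real r * ln (real l) + (1 - 1 / real l) * (\<Sum>u\<in>V. \<phi> u)"
    using m N by (subst (asm) mult_le_cancel_left_pos) auto
  then show ?thesis by (simp only: T_def \<phi>_def)
qed

section \<open>From factors to cycle tilings\<close>

text \<open>The isomorphisms from \<open>F\<close> to \<open>K\<close>, each recorded by the list of its values along \<open>xs\<close>. In this form two
  isomorphisms that agree on the vertices of \<open>F\<close> are identified.\<close>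

definition embedding_lists :: "'a list \<Rightarrow> 'a sgraph \<Rightarrow> 'b sgraph \<Rightarrow> 'b list set" where
  "embedding_lists xs F K =
     {map f xs | f. bij_betw f (verts F) (verts K) \<and> edges K = (\<lambda>e. f ` e) ` edges F}"

text \<open>The edge set of the copy of \<open>F\<close> that is placed on the entries of \<open>L\<close> by \<open>xs ! i \<mapsto> L ! i\<close>. It
  serves to reconstruct a factor from a tiling.\<close>

definition edges_along :: "'a list \<Rightarrow> 'a sgraph \<Rightarrow> 'b list \<Rightarrow> 'b set set" where
  "edges_along xs F L = (\<lambda>e. {L ! i | i. i < length xs \<and> xs ! i \<in> e}) ` edges F"

lemma hamiltonian_obtain_cycle:
  assumes "hamiltonian F"
  obtains xs where "distinct xs" "set xs = verts F" "length xs \<ge> 2"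
    "\<And>i. i < length xs \<Longrightarrow> {xs ! i, xs ! (Suc i mod length xs)} \<in> edges F"
proof -
  define l where "l = card (verts F)"
  obtain H f where H: "l \<ge> 2" "spanning_subgraph H F" "bij_betw f {..<l} (verts H)"
      "edges H = (\<lambda>e. f ` e) ` (\<lambda>i. {i, Suc i mod l}) ` {..<l}"
    using assms unfolding hamiltonian_def graph_iso_def cycle_graph_def l_def by auto
  define xs where "xs = map f [0..<l]"
  have len: "length xs = l" by (simp add: xs_def)
  have "distinct xs" using H(3) by (simp add: xs_def distinct_map bij_betw_def lessThan_atLeast0)
  moreover have "set xs = verts F"
    using H(2,3) by (simp add: xs_def spanning_subgraph_def bij_betw_def lessThan_atLeast0)
  moreover have "{xs ! i, xs ! (Suc i mod length xs)} \<in> edges F" if "i < length xs" for i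
  proof -
    have "Suc i mod l < l" using H(1) by simp
    then have "{xs ! i, xs ! (Suc i mod length xs)} = f ` {i, Suc i mod l}"
      using that unfolding len by (simp add: xs_def)
    also have "\<dots> \<in> edges H" using that len H(4) by blast
    finally show ?thesis using H(2) by (auto simp: spanning_subgraph_def)
  qed
  ultimately show ?thesis using H(1) len by (intro that) auto
qed

lemma embedding_list_facts:
  assumes "L \<in> embedding_lists xs F K" "simple_graph F" "distinct xs" "set xs = verts F"
  shows "length L = length xs" "distinct L" "set L = verts K" "edges_along xs F L = edges K"
    "\<And>i j. i < length xs \<Longrightarrow> j < length xs \<Longrightarrow> {xs ! i, xs ! j} \<in> edges F \<Longrightarrow> {L ! i, L ! j} \<in> edges K"
proof -
  obtain f where f: "L = map f xs" "bij_betw f (verts F) (verts K)" "edges K = (\<lambda>e. f ` e) ` edges F"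
    using assms(1) by (auto simp: embedding_lists_def)
  show "length L = length xs" by (simp add: f)
  show "distinct L" using f assms by (simp add: distinct_map bij_betw_def)
  show "set L = verts K" using f assms by (simp add: bij_betw_def)
  have "{L ! i | i. i < length xs \<and> xs ! i \<in> e} = f ` e" if "e \<in> edges F" for e
  proof -
    have "e \<subseteq> set xs" using that assms(2,4) by (auto simp: simple_graph_def)
    then have "e = {xs ! i | i. i < length xs \<and> xs ! i \<in> e}" unfolding set_conv_nth by blast
    then have "f ` e = f ` {xs ! i | i. i < length xs \<and> xs ! i \<in> e}" by (rule arg_cong)
    also have "\<dots> = {L ! i | i. i < length xs \<and> xs ! i \<in> e}" 
      unfolding setcompr_eq_image image_image f(1) by (rule image_cong) auto
    finally show ?thesis by (rule sym)
  qed
  then show "edges_along xs F L = edges K" by (simp add: edges_along_def f(3) cong: image_cong)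
  show "{L ! i, L ! j} \<in> edges K" if "i < length xs" "j < length xs" "{xs ! i, xs ! j} \<in> edges F" for i j
  proof -
    have "{L ! i, L ! j} = f ` {xs ! i, xs ! j}" using that by (simp add: f(1))
    then show ?thesis using that(3) f(3) by blast
  qed
qed

text \<open>Composing one isomorphism with the automorphisms of \<open>F\<close> yields different lists.\<close>

lemma card_embedding_lists_ge:
  assumes iso: "graph_iso F K" and F: "simple_graph F" and xs: "distinct xs" "set xs = verts F"
  shows "finite (embedding_lists xs F K)" "card (automorphisms F) \<le> card (embedding_lists xs F K)"
proof -
  obtain f where f: "bij_betw f (verts F) (verts K)" "edges K = (\<lambda>e. f ` e) ` edges F"
    using iso by (auto simp: graph_iso_def)
  have "finite (verts K)" using bij_betw_finite[OF f(1)] F by (simp add: simple_graph_def)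
  then have "finite {L. set L \<subseteq> verts K \<and> length L = length xs}" by (rule finite_lists_length_eq)
  moreover have "embedding_lists xs F K \<subseteq> {L. set L \<subseteq> verts K \<and> length L = length xs}"
    using embedding_list_facts(1,3)[OF _ F xs] by blast
  ultimately show fin: "finite (embedding_lists xs F K)" by (rule rev_finite_subset)
  show "card (automorphisms F) \<le> card (embedding_lists xs F K)"
  proof (rule card_inj_on_le[OF _ _ fin])
    show "inj_on (\<lambda>\<alpha>. map (f \<circ> \<alpha>) xs) (automorphisms F)"
    proof (rule inj_onI, rule ext)
      fix \<alpha> \<beta> x assume "\<alpha> \<in> automorphisms F" "\<beta> \<in> automorphisms F"
        and eq: "map (f \<circ> \<alpha>) xs = map (f \<circ> \<beta>) xs"
      then have ab: "\<alpha> permutes verts F" "\<beta> permutes verts F" by (auto simp: automorphisms_def)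
      show "\<alpha> x = \<beta> x"
      proof (cases "x \<in> verts F")
        case True
        then have "f (\<alpha> x) = f (\<beta> x)" using eq xs(2) by (auto simp: map_eq_conv)
        then show ?thesis
          using bij_betw_imp_inj_on[OF f(1)] permutes_in_image[OF ab(1)] permutes_in_image[OF ab(2)] True
          by (auto dest: inj_onD)
      next
        case False
        then show ?thesis using ab by (simp add: permutes_not_in)
      qed
    qed
    show "(\<lambda>\<alpha>. map (f \<circ> \<alpha>) xs) ` automorphisms F \<subseteq> embedding_lists xs F K"
    proof (rule image_subsetI)
      fix \<alpha> assume "\<alpha> \<in> automorphisms F"
      then have \<alpha>: "\<alpha> permutes verts F" "(\<lambda>e. \<alpha> ` e) ` edges F = edges F"
        by (auto simp: automorphisms_def)
      have "bij_betw (f \<circ> \<alpha>) (verts F) (verts K)"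
        using permutes_imp_bij[OF \<alpha>(1)] f(1) by (rule bij_betw_trans)
      moreover have "edges K = (\<lambda>e. (f \<circ> \<alpha>) ` e) ` edges F"
      proof -
        have "edges K = (\<lambda>e. f ` e) ` (\<lambda>e. \<alpha> ` e) ` edges F" by (simp only: \<alpha>(2) f(2))
        then show ?thesis by (simp only: image_image image_comp comp_def)
      qed
      ultimately show "map (f \<circ> \<alpha>) xs \<in> embedding_lists xs F K"
        unfolding embedding_lists_def by blast
    qed
  qed
qed

definition factor_parts :: "'a sgraph \<Rightarrow> 'b sgraph \<Rightarrow> 'b sgraph set \<Rightarrow> bool" where
  "factor_parts F H \<K> \<longleftrightarrow> (\<forall>K\<in>\<K>. graph_iso F K) \<and>
     pairwise (\<lambda>K L. verts K \<inter> verts L = {}) \<K> \<and>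
     verts H = (\<Union>K\<in>\<K>. verts K) \<and> edges H = (\<Union>K\<in>\<K>. edges K)"

text \<open>One isomorphism is chosen independently for each part. Different choices give different tilings because
  the vertex set of a list reveals the part it belongs to. The parts of \<open>\<K>\<close> are nonempty and disjoint, so
  their number is \<open>n / l\<close>.\<close>

lemma factor_parts_tilings:
  assumes F: "simple_graph F" and G: "simple_graph G" and H: "spanning_subgraph H G"
    and parts: "factor_parts F H \<K>"
    and xs: "distinct xs" "set xs = verts F" "length xs = l" "l \<ge> 2"
    and cyc: "\<And>i. i < l \<Longrightarrow> {xs ! i, xs ! (Suc i mod l)} \<in> edges F"
  shows "card (verts G) = l * card \<K>"
    "\<exists>T \<subseteq> cycle_tilings (\<lambda>u. {w \<in> verts G. {u, w} \<in> edges G}) l (verts G).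
      card (automorphisms F) ^ card \<K> \<le> card T \<and>
      (\<forall>S\<in>T. H = SGraph (\<Union>(set ` S)) (\<Union>(edges_along xs F ` S)))"
proof -
  let ?Iso = "embedding_lists xs F"
  have iso: "graph_iso F K" if "K \<in> \<K>" for K using parts that by (simp add: factor_parts_def)
  have VH: "verts H = (\<Union>K\<in>\<K>. verts K)" "edges H = (\<Union>K\<in>\<K>. edges K)"
    using parts by (simp_all add: factor_parts_def)
  have VG: "verts H = verts G" "edges H \<subseteq> edges G" using H by (simp_all add: spanning_subgraph_def)
  have finG: "finite (verts G)" using G by (simp add: simple_graph_def)
  have cardF: "card (verts F) = l" using xs distinct_card by metis
  have cardK: "card (verts K) = l" if "K \<in> \<K>" for K
    using iso[OF that] cardF bij_betw_same_card by (metis graph_iso_def)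
  have disj: "verts K \<inter> verts K' = {}" if "K \<in> \<K>" "K' \<in> \<K>" "K \<noteq> K'" for K K'
    using pairwiseD[of "\<lambda>K L. verts K \<inter> verts L = {}" \<K>] parts that by (simp add: factor_parts_def)
  have inj: "inj_on verts \<K>"
  proof (rule inj_onI, rule ccontr)
    fix K K' assume "K \<in> \<K>" "K' \<in> \<K>" "K \<noteq> K'" and eq: "verts K = verts K'"
    then have "verts K = {}" using disj[of K K'] by simp
    then show False using cardK[OF \<open>K \<in> \<K>\<close>] xs(4) by simp
  qed
  have finK: "finite \<K>"
  proof (rule finite_imageD[OF _ inj])
    show "finite (verts ` \<K>)" by (rule finite_subset[of _ "Pow (verts G)"]) (use finG VG(1) VH(1) in auto)
  qed
  have fv: "finite (verts K)" if "K \<in> \<K>" for K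
    by (rule finite_subset[OF _ finG]) (use VG(1) VH(1) that in auto)
  have "card (verts G) = card (\<Union>K\<in>\<K>. verts K)" using VG VH by simp
  also have "\<dots> = (\<Sum>K\<in>\<K>. card (verts K))"
    by (rule card_UN_disjoint[OF finK]) (use fv disj in blast)+
  also have "\<dots> = (\<Sum>K\<in>\<K>. l)" by (rule sum.cong[OF refl]) (rule cardK)
  finally show "card (verts G) = l * card \<K>" by simp
  have list: "length L = l" "distinct L" "set L = verts K" "edges_along xs F L = edges K"
      "\<And>i. i < l \<Longrightarrow> {L ! i, L ! (Suc i mod l)} \<in> edges K" if "L \<in> ?Iso K" for L K
  proof -
    note E = embedding_list_facts[OF that F xs(1,2)]
    show "length L = l" "distinct L" "set L = verts K" "edges_along xs F L = edges K"
      using E xs(3) by simp_all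
    fix i assume i: "i < l"
    then show "{L ! i, L ! (Suc i mod l)} \<in> edges K"
      using E(5)[of i "Suc i mod l"] cyc[OF i] xs(3,4) by simp
  qed
  define T where "T = (\<lambda>g. g ` \<K>) ` (PiE \<K> ?Iso)"
  have mem: "g K \<in> ?Iso K" if "g \<in> PiE \<K> ?Iso" "K \<in> \<K>" for g K using that by (rule PiE_mem)
  have inj_T: "inj_on (\<lambda>g. g ` \<K>) (PiE \<K> ?Iso)"
  proof (rule inj_onI)
    fix g g' assume g: "g \<in> PiE \<K> ?Iso" "g' \<in> PiE \<K> ?Iso" and eq: "g ` \<K> = g' ` \<K>"
    show "g = g'"
    proof (rule PiE_ext[OF g])
      fix K assume K: "K \<in> \<K>"
      then obtain K' where K': "K' \<in> \<K>" "g K = g' K'" using eq by blast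
      have "verts K = verts K'"
        using list(3)[OF mem[OF g(1) K]] list(3)[OF mem[OF g(2) K'(1)]] K'(2) by simp
      then show "g K = g' K" using inj_onD[OF inj _ K K'(1)] K'(2) by simp
    qed
  qed
  have "card (automorphisms F) ^ card \<K> = (\<Prod>K\<in>\<K>. card (automorphisms F))" by simp
  also have "\<dots> \<le> (\<Prod>K\<in>\<K>. card (?Iso K))"
    by (rule prod_mono) (use card_embedding_lists_ge(2)[OF iso F xs(1,2)] in auto)
  also have "\<dots> = card (PiE \<K> ?Iso)" using finK by (simp add: card_PiE)
  also have "\<dots> = card T" unfolding T_def by (rule card_image[OF inj_T, symmetric])
  finally have cardT: "card (automorphisms F) ^ card \<K> \<le> card T" .
  have "S \<in> cycle_tilings (\<lambda>u. {w \<in> verts G. {u, w} \<in> edges G}) l (verts G) \<and>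
      H = SGraph (\<Union>(set ` S)) (\<Union>(edges_along xs F ` S))" if S: "S \<in> T" for S
  proof -
    obtain g where g: "g \<in> PiE \<K> ?Iso" "S = g ` \<K>" using S unfolding T_def by blast
    note gl = list[OF mem[OF g(1)]]
    have V: "\<Union>(set ` S) = verts H" unfolding g(2) VH(1) by (simp add: gl(3))
    have E: "\<Union>(edges_along xs F ` S) = edges H" unfolding g(2) VH(2) by (simp add: gl(4))
    have "g K \<in> directed_cycles (\<lambda>u. {w \<in> verts G. {u, w} \<in> edges G}) l (verts G)" if K: "K \<in> \<K>" for K
    proof -
      have sub: "verts K \<subseteq> verts G" "edges K \<subseteq> edges G" using VG VH K by auto
      have "g K ! (Suc i mod l) \<in> {w \<in> verts G. {g K ! i, w} \<in> edges G}" if i: "i < l" for i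
      proof -
        have "Suc i mod l < length (g K)" using gl(1)[OF K] i by simp
        then have "g K ! (Suc i mod l) \<in> set (g K)" by (rule nth_mem)
        then show ?thesis using gl(3)[OF K] gl(5)[OF K i] sub by auto
      qed
      then show ?thesis using gl(1-3)[OF K] sub by (simp add: directed_cycles_def)
    qed
    moreover have "pairwise (\<lambda>L L'. set L \<inter> set L' = {}) S"
    proof (rule pairwiseI)
      fix L L' assume "L \<in> S" "L' \<in> S" "L \<noteq> L'"
      then obtain K K' where "K \<in> \<K>" "K' \<in> \<K>" "L = g K" "L' = g K'" "K \<noteq> K'" using g(2) by blast
      then show "set L \<inter> set L' = {}" using disj gl(3) by simp
    qed
    moreover from calculation have "S \<subseteq> directed_cycles (\<lambda>u. {w \<in> verts G. {u, w} \<in> edges G}) l (verts G)"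
      unfolding g(2) by (intro image_subsetI)
    ultimately have "S \<in> cycle_tilings (\<lambda>u. {w \<in> verts G. {u, w} \<in> edges G}) l (verts G)"
      using V VG(1) by (simp add: cycle_tilings_def)
    moreover have "H = SGraph (\<Union>(set ` S)) (\<Union>(edges_along xs F ` S))" unfolding V E by simp
    ultimately show ?thesis by simp
  qed
  then show "\<exists>T \<subseteq> cycle_tilings (\<lambda>u. {w \<in> verts G. {u, w} \<in> edges G}) l (verts G).
      card (automorphisms F) ^ card \<K> \<le> card T \<and>
      (\<forall>S\<in>T. H = SGraph (\<Union>(set ` S)) (\<Union>(edges_along xs F ` S)))"
    using cardT by (intro exI[of _ T]) auto
qed

text \<open>Tilings that arise from different factors are different, since \<open>edges_along\<close> recovers the factor; hence
  the families of tilings belonging to the factors are disjoint.\<close>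

lemma N_factor_times_automorphisms_le:
  assumes F: "simple_graph F" and ham: "hamiltonian F" and G: "simple_graph G"
    and N: "N_factor F G > 0" and l: "l = card (verts F)"
  shows "\<exists>r. card (verts G) = l * r \<and> N_factor F G * card (automorphisms F) ^ r \<le>
    card (cycle_tilings (\<lambda>u. {w \<in> verts G. {u, w} \<in> edges G}) l (verts G))"
proof -
  obtain xs where xs: "distinct xs" "set xs = verts F" "length xs \<ge> 2"
      "\<And>i. i < length xs \<Longrightarrow> {xs ! i, xs ! (Suc i mod length xs)} \<in> edges F"
    by (rule hamiltonian_obtain_cycle[OF ham]) blast
  have lx: "length xs = l" using distinct_card[OF xs(1)] xs(2) l by simp
  have l2: "l \<ge> 2" using xs(3) lx by simp
  let ?W = "cycle_tilings (\<lambda>u. {w \<in> verts G. {u, w} \<in> edges G}) l (verts G)"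
  let ?\<F> = "{H. is_factor F G H}"
  define r where "r = card (verts G) div l"
  have fac: "card (verts G) = l * r \<and> (\<exists>T \<subseteq> ?W. card (automorphisms F) ^ r \<le> card T \<and>
      (\<forall>S\<in>T. H = SGraph (\<Union>(set ` S)) (\<Union>(edges_along xs F ` S))))" if H: "is_factor F G H" for H
  proof -
    obtain \<K> where K: "spanning_subgraph H G" "factor_parts F H \<K>"
      using H unfolding is_factor_def factor_parts_def by blast
    note fp = factor_parts_tilings[OF F G K xs(1,2) lx l2 xs(4)[unfolded lx]]
    have "card \<K> = r" using fp(1) l2 by (simp add: r_def)
    then show ?thesis using fp by simp
  qed
  have finF: "finite ?\<F>" by (rule finite_factors[OF G])
  have finW: "finite ?W" using G by (intro finite_cycle_tilings) (simp add: simple_graph_def)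
  obtain H0 where "is_factor F G H0" using N unfolding N_factor_def card_gt_0_iff by blast
  then have r: "card (verts G) = l * r" using fac by blast
  have "\<forall>H\<in>?\<F>. \<exists>T. T \<subseteq> ?W \<and> card (automorphisms F) ^ r \<le> card T \<and>
      (\<forall>S\<in>T. H = SGraph (\<Union>(set ` S)) (\<Union>(edges_along xs F ` S)))"
    using fac by simp
  from bchoice[OF this] obtain T where T: "\<And>H. is_factor F G H \<Longrightarrow> T H \<subseteq> ?W"
      "\<And>H. is_factor F G H \<Longrightarrow> card (automorphisms F) ^ r \<le> card (T H)"
      "\<And>H S. is_factor F G H \<Longrightarrow> S \<in> T H \<Longrightarrow> H = SGraph (\<Union>(set ` S)) (\<Union>(edges_along xs F ` S))"
    by blast
  have "N_factor F G * card (automorphisms F) ^ r = (\<Sum>H\<in>?\<F>. card (automorphisms F) ^ r)"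
    by (simp only: N_factor_def sum_constant of_nat_id)
  also have "\<dots> \<le> (\<Sum>H\<in>?\<F>. card (T H))" by (rule sum_mono) (use T(2) in simp)
  also have "\<dots> = card (\<Union>H\<in>?\<F>. T H)"
  proof (rule card_UN_disjoint[symmetric, OF finF])
    show "\<forall>H\<in>?\<F>. finite (T H)" using T(1) finW finite_subset by blast
    show "\<forall>H\<in>?\<F>. \<forall>H'\<in>?\<F>. H \<noteq> H' \<longrightarrow> T H \<inter> T H' = {}"
    proof (intro ballI impI)
      fix H H' assume HH: "H \<in> ?\<F>" "H' \<in> ?\<F>" "H \<noteq> H'"
      show "T H \<inter> T H' = {}"
      proof (rule equals0I)
        fix S assume "S \<in> T H \<inter> T H'"
        then have "H = H'" using T(3)[of H S] T(3)[of H' S] HH(1,2) by simp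
        then show False using HH(3) by simp
      qed
    qed
  qed
  also have "\<dots> \<le> card ?W" by (rule card_mono[OF finW]) (use T(1) in blast)
  finally show ?thesis using r by blast
qed

section \<open>The bound on the number of factors\<close>

theorem theorem1p4:
  fixes \<epsilon> :: real and F :: "'a sgraph"
  assumes "\<epsilon> > 0" and "simple_graph F" and "hamiltonian F"
  shows "\<exists>C::real. C > 0 \<and>
    (\<forall>(n::nat) (G :: 'b sgraph). n \<ge> 1 \<longrightarrow> simple_graph G \<longrightarrow> card (verts G) = n \<longrightarrow>
      real (N_factor F G) \<le>
        ((1 + \<epsilon>) * (real (card (verts F)) / real (card (automorphisms F))))
            powr (real n / real (card (verts F))) *
        (\<Prod>v\<in>verts G. (real (degree G v) + C) / exp 1)
            powr (1 - 1 / real (card (verts F))))"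
proof -
  define l where "l = card (verts F)"
  define a where "a = card (automorphisms F)"
  \<comment> \<open>The error \<open>\<eta>\<close> occurs once per vertex, that is \<open>l * r\<close> times, while \<open>1 + \<epsilon>\<close> has the exponent \<open>r\<close>.\<close>
  define \<eta> where "\<eta> = ln (1 + \<epsilon>) / real l"
  have l: "l \<ge> 2" using assms(3) by (simp add: l_def hamiltonian_def)
  have a: "a > 0"
  proof -
    have "finite (verts F)" using assms(2) by (simp add: simple_graph_def)
    then have "finite {f. f permutes verts F}" by (rule finite_permutations)
    then have "finite (automorphisms F)"
      by (rule rev_finite_subset) (auto simp: automorphisms_def)
    moreover have "id \<in> automorphisms F" by (simp add: automorphisms_def permutes_id)
    ultimately show ?thesis unfolding a_def card_gt_0_iff by blast
  qed
  have lnpos: "ln (1 + \<epsilon>) > 0" using assms(1) by simp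
  have \<eta>: "\<eta> > 0" using lnpos l by (simp add: \<eta>_def)
  obtain C where C: "C > 0" "\<And>r d. r \<ge> 1 \<Longrightarrow> d \<le> l * r \<Longrightarrow>
      (\<Sum>j=1..r. ln (real l + real d * (real j / real r))) / real r \<le> ln ((real d + C) / exp 1) + \<eta>"
    using average_ln_le[of \<eta> l] \<eta> l by auto
  have "real (N_factor F G) \<le> ((1 + \<epsilon>) * (real l / real a)) powr (real n / real l) *
        (\<Prod>v\<in>verts G. (real (degree G v) + C) / exp 1) powr (1 - 1 / real l)"
    if n: "n \<ge> 1" and G: "simple_graph G" "card (verts G) = n" for n and G :: "'b sgraph"
  proof (cases "N_factor F G = 0")
    case True
    then show ?thesis by simp
  next
    case False
    define nb where "nb u = {w \<in> verts G. {u, w} \<in> edges G}" for u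
    define W where "W = cycle_tilings nb l (verts G)"
    have V: "finite (verts G)" using G by (simp add: simple_graph_def)
    obtain r where r: "card (verts G) = l * r" and NW: "N_factor F G * a ^ r \<le> card W"
      using N_factor_times_automorphisms_le[OF assms(2,3) G(1) _ l_def] False
      unfolding W_def nb_def a_def by auto
    have r1: "r \<ge> 1" using r n G(2) by (cases r) auto
    have pos: "0 < real (N_factor F G) * real a ^ r" using False a by simp
    have NW': "real (N_factor F G) * real a ^ r \<le> real (card W)"
      using of_nat_mono[OF NW, where 'a = real] by simp
    have Wne: "W \<noteq> {}" using pos NW' by auto
    define X where "X v = (real (degree G v) + C) / exp 1" for v
    have X: "X v > 0" for v using C(1) by (simp add: X_def add_nonneg_pos)
    have deg: "card (nb u \<inter> verts G) = degree G u" for u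
      unfolding nb_def degree_def by (rule arg_cong[of _ _ card]) auto
    have "ln (real (N_factor F G)) + real r * ln (real a) = ln (real (N_factor F G) * real a ^ r)"
      using False a by (simp add: ln_mult_pos ln_realpow)
    also have "\<dots> \<le> ln (real (card W))" using NW' pos by (rule ln_mono)
    also have "\<dots> \<le> real r * ln (real l) + (1 - 1 / real l) *
        (\<Sum>u\<in>verts G. (\<Sum>j=1..r. ln (real l + real (degree G u) * (real j / real r))) / real r)"
      using ln_card_cycle_tilings_le[OF V _ r, of nb] Wne l unfolding W_def deg by simp
    also have "\<dots> \<le> real r * ln (real l) + (1 - 1 / real l) * (\<Sum>u\<in>verts G. ln (X u) + \<eta>)"
    proof (intro add_left_mono mult_left_mono sum_mono)
      fix u
      have "degree G u \<le> l * r" unfolding r[symmetric] degree_def by (rule card_mono[OF V]) auto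
      then show "(\<Sum>j=1..r. ln (real l + real (degree G u) * (real j / real r))) / real r \<le> ln (X u) + \<eta>"
        unfolding X_def by (rule C(2)[OF r1])
    qed (use l in simp)
    also have "(\<Sum>u\<in>verts G. ln (X u) + \<eta>) = ln (\<Prod>u\<in>verts G. X u) + real r * ln (1 + \<epsilon>)"
    proof -
      have nz: "X u \<noteq> 0" for u using X[of u] by linarith
      have "real (card (verts G)) * \<eta> = real r * ln (1 + \<epsilon>)"
        using l by (simp add: r \<eta>_def)
      then show ?thesis by (simp only: sum.distrib sum_constant ln_prod[OF V nz])
    qed
    also have "real r * ln (real l) + (1 - 1 / real l) * (ln (\<Prod>u\<in>verts G. X u) + real r * ln (1 + \<epsilon>)) \<le>
        real r * ln (real l) + (1 - 1 / real l) * ln (\<Prod>u\<in>verts G. X u) + real r * ln (1 + \<epsilon>)"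
    proof -
      have "(1 - 1 / real l) * (real r * ln (1 + \<epsilon>)) \<le> 1 * (real r * ln (1 + \<epsilon>))"
        using lnpos by (intro mult_right_mono) auto
      then show ?thesis by (simp only: distrib_left mult_1_left)
    qed
    finally have "ln (real (N_factor F G)) \<le> real r * (ln (1 + \<epsilon>) + ln (real l) - ln (real a)) +
        (1 - 1 / real l) * ln (\<Prod>u\<in>verts G. X u)"
      by (simp add: algebra_simps)
    also have "ln (1 + \<epsilon>) + ln (real l) - ln (real a) = ln ((1 + \<epsilon>) * (real l / real a))"
      using assms(1) l a by (simp add: ln_mult_pos ln_divide_pos)
    also have "real r * ln ((1 + \<epsilon>) * (real l / real a)) + (1 - 1 / real l) * ln (\<Prod>u\<in>verts G. X u) =
        ln (((1 + \<epsilon>) * (real l / real a)) powr real r * (\<Prod>u\<in>verts G. X u) powr (1 - 1 / real l))"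
      using assms(1) l a prod_pos[of "verts G" X] X by (subst ln_mult_pos) (auto simp: ln_powr less_imp_neq[symmetric])
    finally have "real (N_factor F G) \<le>
        ((1 + \<epsilon>) * (real l / real a)) powr real r * (\<Prod>u\<in>verts G. X u) powr (1 - 1 / real l)"
      using False assms(1) l a prod_pos[of "verts G" X] X by (subst (asm) ln_le_cancel_iff) auto
    moreover have "real n / real l = real r" using r G(2) l by auto
    ultimately show ?thesis by (simp add: X_def)
  qed
  then show ?thesis using C(1) unfolding l_def a_def by blast
qed

end
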